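(* Let $(G,\tau,\partial)$ be a Polish topometric group admitting (topometric) ample generics. Then $G$ has the small density property: whenever $H\colon G \to [0,\infty]$ is a graded subgroup which is lower semi-continuous with respect to $\partial$ and whose index $[G:H]$ is strictly less than $2^{\aleph_0}$, $H$ is upper semi-continuous (and hence continuous) with respect to $\tau$.
   Context: A Polish topometric group is a triple $(G,\tau,\partial)$ where $(G,\tau)$ is a Polish group and $\partial$ is a complete bi-invariant metric on $G$ whose topology refines $\tau$ and which is $\tau$-lower semi-continuous, i.e. $\{(g,h)\colon \partial(g,h) \leq r\}$ is $\tau$-closed in $G \times G$ for every $r$. It has (topometric) ample generics if for every $n \in \mathbb{N}$ there is $(g_1,\ldots,g_n) \in G^n$ such that the $\partial$-closure (for the maximum metric on $G^n$) of $\{(kg_1k^{-1},\ldots,kg_nk^{-1}) \colon k \in G\}$ is co-meagre in $(G^n,\tau)$. A graded subgroup is a function $H\colon G \to [0,\infty]$ with $H(1)=0$, $H(x)=H(x^{-1})$ and $H(hg)\leq H(h)+H(g)$ for all $g,h$. It defines the left-invariant pseudo-metric $d_H(g,h) = H(g^{-1}h)$ (possibly taking value $\infty$), and the index $[G:H]$ is the density character of $d_H$, i.e. the least cardinality of a $d_H$-dense subset of $G$. $H$ is $\partial$-closed if it is lower semi-continuous for the topology of $\partial$. *)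

theory Defs
  imports "HOL-Analysis.Analysis" "HOL-Algebra.Group" "HOL-Library.Equipollence"
begin

definition Polish_space :: "'a topology \<Rightarrow> bool" where
  "Polish_space X \<longleftrightarrow> completely_metrizable_space X \<and> separable_space X"

definition comeagre_in :: "'a topology \<Rightarrow> 'a set \<Rightarrow> bool" where
  "comeagre_in X S \<longleftrightarrow> S \<subseteq> topspace X \<and>
     (\<exists>U :: nat \<Rightarrow> 'a set. (\<forall>n. openin X (U n) \<and> X closure_of (U n) = topspace X)
        \<and> topspace X \<inter> (\<Inter>n. U n) \<subseteq> S)"

definition Polish_topometric_group ::
  "('a, 'b) monoid_scheme \<Rightarrow> 'a topology \<Rightarrow> ('a \<Rightarrow> 'a \<Rightarrow> real) \<Rightarrow> bool" where
  "Polish_topometric_group G \<tau> d \<longleftrightarrow>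
     group G \<and> topspace \<tau> = carrier G \<and> Polish_space \<tau>
     \<and> continuous_map (prod_topology \<tau> \<tau>) \<tau> (\<lambda>(x, y). x \<otimes>\<^bsub>G\<^esub> y)
     \<and> continuous_map \<tau> \<tau> (\<lambda>x. inv\<^bsub>G\<^esub> x)
     \<and> Metric_space (carrier G) d \<and> Metric_space.mcomplete (carrier G) d
     \<and> (\<forall>k\<in>carrier G. \<forall>x\<in>carrier G. \<forall>y\<in>carrier G.
           d (k \<otimes>\<^bsub>G\<^esub> x) (k \<otimes>\<^bsub>G\<^esub> y) = d x y \<and> d (x \<otimes>\<^bsub>G\<^esub> k) (y \<otimes>\<^bsub>G\<^esub> k) = d x y)
     \<and> (\<forall>U. openin \<tau> U \<longrightarrow> openin (Metric_space.mtopology (carrier G) d) U)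
     \<and> (\<forall>r. closedin (prod_topology \<tau> \<tau>) {(g, h) \<in> carrier G \<times> carrier G. d g h \<le> r})"

definition orbit_dclosure ::
  "('a, 'b) monoid_scheme \<Rightarrow> ('a \<Rightarrow> 'a \<Rightarrow> real) \<Rightarrow> nat \<Rightarrow> (nat \<Rightarrow> 'a) \<Rightarrow> (nat \<Rightarrow> 'a) set" where
  "orbit_dclosure G d n g = {y \<in> {..<n} \<rightarrow>\<^sub>E carrier G.
     \<forall>\<epsilon>>0. \<exists>k\<in>carrier G. \<forall>i<n. d (y i) (k \<otimes>\<^bsub>G\<^esub> g i \<otimes>\<^bsub>G\<^esub> inv\<^bsub>G\<^esub> k) < \<epsilon>}"

definition ample_generics ::
  "('a, 'b) monoid_scheme \<Rightarrow> 'a topology \<Rightarrow> ('a \<Rightarrow> 'a \<Rightarrow> real) \<Rightarrow> bool" where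
  "ample_generics G \<tau> d \<longleftrightarrow> (\<forall>n::nat. \<exists>g \<in> {..<n} \<rightarrow>\<^sub>E carrier G.
     comeagre_in (product_topology (\<lambda>_. \<tau>) {..<n}) (orbit_dclosure G d n g))"

definition graded_subgroup :: "('a, 'b) monoid_scheme \<Rightarrow> ('a \<Rightarrow> ennreal) \<Rightarrow> bool" where
  "graded_subgroup G H \<longleftrightarrow> H \<one>\<^bsub>G\<^esub> = 0
     \<and> (\<forall>x\<in>carrier G. H (inv\<^bsub>G\<^esub> x) = H x)
     \<and> (\<forall>g\<in>carrier G. \<forall>h\<in>carrier G. H (h \<otimes>\<^bsub>G\<^esub> g) \<le> H h + H g)"

definition dH_dense :: "('a, 'b) monoid_scheme \<Rightarrow> ('a \<Rightarrow> ennreal) \<Rightarrow> 'a set \<Rightarrow> bool" where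
  "dH_dense G H D \<longleftrightarrow> D \<subseteq> carrier G \<and>
     (\<forall>g\<in>carrier G. \<forall>\<epsilon>::real>0. \<exists>x\<in>D. H (inv\<^bsub>G\<^esub> g \<otimes>\<^bsub>G\<^esub> x) < ennreal \<epsilon>)"

text \<open>[G:H] < 2^aleph_0: the density character of d_H is below the continuum,
  i.e. some d_H-dense set has cardinality strictly less than that of the reals.\<close>
definition index_lt_continuum :: "('a, 'b) monoid_scheme \<Rightarrow> ('a \<Rightarrow> ennreal) \<Rightarrow> bool" where
  "index_lt_continuum G H \<longleftrightarrow> (\<exists>D. dH_dense G H D \<and> D \<prec> (UNIV :: real set))"

definition lsc_on :: "'a topology \<Rightarrow> ('a \<Rightarrow> ennreal) \<Rightarrow> bool" where
  "lsc_on X f \<longleftrightarrow> (\<forall>c. openin X {x \<in> topspace X. c < f x})"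

definition usc_on :: "'a topology \<Rightarrow> ('a \<Rightarrow> ennreal) \<Rightarrow> bool" where
  "usc_on X f \<longleftrightarrow> (\<forall>c. openin X {x \<in> topspace X. f x < c})"

end

theory Submission
  imports Defs
begin

text \<open>
  For a \<open>d\<close>-Lipschitz graded subgroup \<open>L\<close> of small index the argument of Kechris and Rosendal
    for the small
  index property adapts: if \<open>L\<close> were not continuous at the identity,
    \<open>{L > r / 2}\<close> would be non-meagre in
  every open set (Pettis), while \<open>{L < r / 8}\<close> is non-meagre
    (Mycielski), and ample generics give a binary tree
  of conjugators whose branches form continuum many uniformly \<open>L\<close>-separated points. Being Lipschitz
    makes the
  errors coming from \<open>d\<close>-closures of orbits harmless. A general \<open>d\<close>-lower semi-continuous
    \<open>H\<close> is the supremum of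
  the Lipschitz graded subgroups \<open>x \<mapsto> inf\<^sub>y (H y + c d x y)\<close>, because \<open>d\<close> is bi-invariant. So
    \<open>H\<close> is lower
  semi-continuous for \<open>\<tau>\<close> itself; its non-meagre sublevel sets are closed, hence have interior, and
    upper
  semi-continuity follows.
\<close>

section \<open>Baire category\<close>

text \<open>Ample generics only makes the \<open>d\<close>-closure of an orbit comeagre, so Effros'
  theorem, which needs a comeagre orbit, cannot supply conjugators close to the identity. The tree
  asks for less: one \<open>f\<close> that moves the current \<open>h\<close> little, nearly fixes
  the entries already chosen and nearly carries a new entry \<open>y1\<close> to a new entry
  \<open>y0\<close>. Cutting the group into countably many small pieces provides it.

  Suppose branches \<open>a\<close> and \<open>b\<close> part at level \<open>i\<close>, with
  \<open>a\<close> taking \<open>y1\<close> and \<open>b\<close> taking \<open>y0\<close>.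
  Conjugating \<open>y1\<close> by \<open>h a\<close> and \<open>y0\<close> by \<open>h b\<close>
  gives nearly the same point, so \<open>k = inv (h a) \<otimes> h b\<close> nearly conjugates
  \<open>y0\<close> to \<open>y1\<close>. If \<open>L k < r / 8\<close>, then \<open>L y1\<close> is
  at most \<open>L k + L y0 + L k\<close> plus the Lipschitz error: four terms of at most
  \<open>r / 8\<close>, against \<open>L y1 > r / 2\<close>. This is the origin of the thresholds.

  Membership in the orbit closures would not survive infinitely many extensions, so the tuples stay
  in smaller sets \<open>R n\<close>, each member of which has comeagrely many extensions in
  \<open>R (Suc n)\<close>.\<close>

definition dense_openin :: "'a topology \<Rightarrow> 'a set \<Rightarrow> bool" where
  "dense_openin X U \<longleftrightarrow> openin X U \<and> X closure_of U = topspace X"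

definition meagre_in :: "'a topology \<Rightarrow> 'a set \<Rightarrow> bool" where
  "meagre_in X S \<longleftrightarrow> comeagre_in X (topspace X - S)"

lemma dense_openin_iff:
  "dense_openin X U \<longleftrightarrow> openin X U \<and> (\<forall>V. openin X V \<and> V \<noteq> {} \<longrightarrow> U \<inter> V \<noteq> {})"
  by (simp add: dense_openin_def dense_intersects_open)

lemma dense_openin_topspace: "dense_openin X (topspace X)"
  by (simp add: dense_openin_def)

lemma comeagre_in_altdef:
  "comeagre_in X S \<longleftrightarrow> S \<subseteq> topspace X \<and>
    (\<exists>U::nat \<Rightarrow> 'a set. (\<forall>n. dense_openin X (U n)) \<and> topspace X \<inter>
      (\<Inter>n. U n) \<subseteq> S)" for X :: "'a topology"
  by (simp add: comeagre_in_def dense_openin_def)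

lemma comeagre_in_countable:
  assumes "countable F" "\<And>U. U \<in> F \<Longrightarrow> dense_openin X U" "S \<subseteq> topspace X" "topspace X \<inter> \<Inter>F \<subseteq> S"
  shows "comeagre_in X S"
proof -
  \<comment> \<open>Adding the dense open set \<open>topspace X\<close> makes the family non-empty,
    as its enumeration by \<open>nat\<close> requires.\<close>
  have c: "countable (insert (topspace X) F)" and ne: "insert (topspace X) F \<noteq> {}"
    using assms by auto
  define U where "U = from_nat_into (insert (topspace X) F)"
  have r: "range U = insert (topspace X) F"
    unfolding U_def by (rule range_from_nat_into[OF ne c])
  have "dense_openin X (U n)" for n
    using r assms(2) dense_openin_topspace by (metis insertE rangeI)
  moreover have "topspace X \<inter> (\<Inter>n. U n) \<subseteq> S"
    using r assms(4) by auto
  ultimately show ?thesis using assms(3) by (auto simp: comeagre_in_altdef)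
qed

lemma comeagre_in_subset_topspace: "comeagre_in X S \<Longrightarrow> S \<subseteq> topspace X"
  by (simp add: comeagre_in_def)

lemma comeagre_in_mono:
  "comeagre_in X S \<Longrightarrow> S \<subseteq> T \<Longrightarrow> T \<subseteq> topspace X \<Longrightarrow> comeagre_in X T"
  unfolding comeagre_in_def by (meson order_trans)

lemma dense_openin_imp_comeagre_in: "dense_openin X U \<Longrightarrow> comeagre_in X U"
  by (rule comeagre_in_countable[of "{U}"]) (auto simp: dense_openin_def openin_subset)

lemma comeagre_in_topspace: "comeagre_in X (topspace X)"
  by (rule dense_openin_imp_comeagre_in[OF dense_openin_topspace])

lemma comeagre_in_INT:
  assumes "\<And>n::nat. comeagre_in X (S n)"
  shows "comeagre_in X (\<Inter>n. S n)"
proof -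
  have "\<forall>n. \<exists>U::nat \<Rightarrow> _. (\<forall>i. dense_openin X (U i)) \<and> topspace X \<inter> (\<Inter>i. U i) \<subseteq> S n"
    using assms by (auto simp: comeagre_in_altdef)
  then obtain U where U: "\<And>n i::nat. dense_openin X (U n i)"
      "\<And>n. topspace X \<inter> (\<Inter>i. U n i) \<subseteq> S n"
    by metis
  show ?thesis
  proof (rule comeagre_in_countable[of "range (\<lambda>(n, i). U n i)"])
    show "(\<Inter>n. S n) \<subseteq> topspace X"
      using comeagre_in_subset_topspace[OF assms] by blast
    show "topspace X \<inter> \<Inter> (range (\<lambda>(n, i). U n i)) \<subseteq> (\<Inter>n. S n)"
      using U(2) by fastforce
  qed (use U in auto)
qed

text \<open>For empty \<open>I\<close> the bare intersection is \<open>UNIV\<close>; hence the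
  intersection with \<open>topspace X\<close>.\<close>

lemma comeagre_in_INT_countable:
  assumes "countable I" "\<And>i. i \<in> I \<Longrightarrow> comeagre_in X (S i)"
  shows "comeagre_in X (topspace X \<inter> (\<Inter>i\<in>I. S i))"
proof (cases "I = {}")
  case True
  then show ?thesis by (simp add: comeagre_in_topspace)
next
  case False
  have "comeagre_in X (\<Inter>n. S (from_nat_into I n))"
    by (intro comeagre_in_INT assms from_nat_into False)
  moreover have "(\<Inter>n. S (from_nat_into I n)) = (\<Inter>i\<in>I. S i)"
    using range_from_nat_into[OF False assms(1)] by (metis image_image)
  ultimately show ?thesis
    by (metis comeagre_in_subset_topspace inf.absorb_iff2)
qed

lemma meagre_in_subset: "meagre_in X T \<Longrightarrow> S \<inter> topspace X \<subseteq> T \<Longrightarrow> meagre_in X S"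
  unfolding meagre_in_def by (erule comeagre_in_mono) auto

lemma meagre_in_UN:
  assumes "countable I" "\<And>i. i \<in> I \<Longrightarrow> meagre_in X (S i)"
  shows "meagre_in X (\<Union>i\<in>I. S i)"
proof -
  have "comeagre_in X (topspace X \<inter> (\<Inter>i\<in>I. topspace X - S i))"
    using assms by (intro comeagre_in_INT_countable) (auto simp: meagre_in_def)
  moreover have "topspace X \<inter> (\<Inter>i\<in>I. topspace X - S i) = topspace X - (\<Union>i\<in>I. S i)"
    by auto
  ultimately show ?thesis by (simp add: meagre_in_def)
qed

lemma meagre_in_Un:
  assumes "meagre_in X S" "meagre_in X T" shows "meagre_in X (S \<union> T)"
proof -
  have "meagre_in X (\<Union>A\<in>{S, T}. A)"
    by (rule meagre_in_UN) (use assms in auto)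
  then show ?thesis by simp
qed

lemma meagre_in_empty: "meagre_in X {}"
  by (simp add: meagre_in_def comeagre_in_topspace)

lemma comeagre_in_imp_meagre_in: "comeagre_in X S \<Longrightarrow> meagre_in X (topspace X - S)"
  unfolding meagre_in_def by (metis comeagre_in_subset_topspace double_diff order_refl)

lemma not_meagre_in_Int_comeagre_in:
  assumes "\<not> meagre_in X S" "comeagre_in X C"
  shows "\<not> meagre_in X (S \<inter> C)"
proof
  assume "meagre_in X (S \<inter> C)"
  then have "meagre_in X (S \<inter> C \<union> (topspace X - C))"
    by (intro meagre_in_Un comeagre_in_imp_meagre_in assms)
  then have "meagre_in X S" by (rule meagre_in_subset) auto
  then show False using assms by simp
qed

lemma not_meagre_in_open:
  assumes "completely_metrizable_space X" "openin X U" "U \<noteq> {}"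
  shows "\<not> meagre_in X U"
proof
  assume "meagre_in X U"
  then obtain V :: "nat \<Rightarrow> _" where V: "\<And>n. dense_openin X (V n)" "topspace X \<inter> (\<Inter>n. V n)
      \<subseteq> topspace X - U"
    by (auto simp: meagre_in_def comeagre_in_altdef)
  have "X closure_of \<Inter>(range V) = topspace X"
    using assms(1) V(1) by (intro Baire_category) (auto simp: dense_openin_def)
  then have "\<Inter>(range V) \<inter> U \<noteq> {}"
    using assms by (simp add: dense_intersects_open)
  then show False using V(2) openin_subset[OF assms(2)] by blast
qed

lemma comeagre_in_vimage:
  assumes f: "homeomorphic_map X Y f" and S: "comeagre_in Y S"
  shows "comeagre_in X {x \<in> topspace X. f x \<in> S}"
proof -
  obtain U :: "nat \<Rightarrow> _" where U: "\<And>n. dense_openin Y (U n)" "topspace Y \<inter> (\<Inter>n. U n) \<subseteq> S"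
    using S by (auto simp: comeagre_in_altdef)
  have cm: "continuous_map X Y f" and om: "open_map X Y f" and ft: "f ` topspace X = topspace Y"
    using f by (simp_all add: homeomorphic_imp_continuous_map homeomorphic_imp_open_map
        homeomorphic_imp_surjective_map)
  show ?thesis
  proof (rule comeagre_in_countable[of "range (\<lambda>n. {x \<in> topspace X. f x \<in> U n})"])
    fix W assume "W \<in> range (\<lambda>n. {x \<in> topspace X. f x \<in> U n})"
    then obtain n where W: "W = {x \<in> topspace X. f x \<in> U n}" by auto
    have "W \<inter> V \<noteq> {}" if V: "openin X V" "V \<noteq> {}" for V
    proof -
      have "openin Y (f ` V)" using om V by (auto simp: open_map_def)
      then have "U n \<inter> f ` V \<noteq> {}" using U(1) V by (auto simp: dense_openin_iff)
      then show ?thesis using W openin_subset[OF V(1)] by auto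
    qed
    moreover have "openin X W"
      unfolding W using U(1) cm by (auto simp: dense_openin_def intro:
        openin_continuous_map_preimage)
    ultimately show "dense_openin X W" by (auto simp: dense_openin_iff)
  next
    show "topspace X \<inter> \<Inter> (range (\<lambda>n. {x \<in> topspace X. f x \<in> U n})) \<subseteq> {x \<in> topspace X. f x \<in> S}"
      using U(2) ft by auto
  qed auto
qed

lemma meagre_in_vimage:
  assumes f: "homeomorphic_map X Y f" and S: "meagre_in Y S"
  shows "meagre_in X {x \<in> topspace X. f x \<in> S}"
proof -
  have "comeagre_in X {x \<in> topspace X. f x \<in> topspace Y - S}"
    using S by (intro comeagre_in_vimage[OF f]) (simp add: meagre_in_def)
  then show ?thesis unfolding meagre_in_def by (rule comeagre_in_mono) auto
qed

text \<open>Let \<open>K\<close> be the union of the basic open sets in which \<open>S\<close> is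
  meagre. The basis is countable, so \<open>S\<close> is meagre in \<open>K\<close>; if
  \<open>K\<close> were dense, \<open>S\<close> would be meagre. Any non-empty open set disjoint
  from \<open>K\<close> works.\<close>

lemma not_meagre_in_localize:
  assumes sc: "second_countable X" and S: "\<not> meagre_in X S"
  obtains U where "openin X U" "U \<noteq> {}" "\<And>V. openin X V \<Longrightarrow> V \<noteq> {} \<Longrightarrow> V \<subseteq> U \<Longrightarrow> \<not> meagre_in X (S \<inter> V)"
proof -
  obtain B where B: "countable B" "\<And>V. V \<in> B \<Longrightarrow> openin X V"
      "\<And>U x. openin X U \<Longrightarrow> x \<in> U \<Longrightarrow> \<exists>V \<in> B. x \<in> V \<and> V \<subseteq> U"
    using sc unfolding second_countable_def by metis
  define K where "K = \<Union>{V\<in>B. meagre_in X (S \<inter> V)}"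
  have K: "openin X K" unfolding K_def using B by auto
  have SK: "meagre_in X (S \<inter> K)"
  proof -
    have "meagre_in X (\<Union>V\<in>{V\<in>B. meagre_in X (S \<inter> V)}. S \<inter> V)"
      using B(1) by (intro meagre_in_UN) auto
    then show ?thesis by (rule meagre_in_subset) (auto simp: K_def)
  qed
  have "\<not> dense_openin X K"
  proof
    assume "dense_openin X K"
    then have "meagre_in X (S \<inter> K \<union> (topspace X - K))"
      by (intro meagre_in_Un SK comeagre_in_imp_meagre_in dense_openin_imp_comeagre_in)
    then have "meagre_in X S" by (rule meagre_in_subset) auto
    with S show False ..
  qed
  then obtain U where U: "openin X U" "U \<noteq> {}" "K \<inter> U = {}"
    using K by (auto simp: dense_openin_iff)
  have "\<not> meagre_in X (S \<inter> V)" if V: "openin X V" "V \<noteq> {}" "V \<subseteq> U" for V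
  proof
    assume m: "meagre_in X (S \<inter> V)"
    obtain x where x: "x \<in> V" using V by auto
    then obtain W where W: "W \<in> B" "x \<in> W" "W \<subseteq> V" using B(3) V by metis
    have "meagre_in X (S \<inter> W)" by (rule meagre_in_subset[OF m]) (use W in auto)
    then have "W \<subseteq> K" using W by (auto simp: K_def)
    then show False using U W V by auto
  qed
  with U that show thesis by blast
qed

text \<open>One direction of the Kuratowski-Ulam theorem. \<open>T n b\<close> is the projection of
  the part of \<open>U n\<close> above \<open>b\<close>, hence open and dense. A point
  \<open>x\<close> in all of these, for \<open>b\<close> in a countable basis, has a dense section
  in every \<open>U n\<close>.\<close>

lemma comeagre_in_section:
  assumes sc: "second_countable Y" and S: "comeagre_in (prod_topology X Y) S"
  shows "comeagre_in X {x \<in> topspace X. comeagre_in Y {y. (x, y) \<in> S}}"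
proof -
  obtain U :: "nat \<Rightarrow> _" where U: "\<And>n. dense_openin (prod_topology X Y) (U n)"
      "topspace (prod_topology X Y) \<inter> (\<Inter>n. U n) \<subseteq> S"
    using S by (auto simp: comeagre_in_altdef)
  obtain B where B: "countable B" "\<And>V. V \<in> B \<Longrightarrow> openin Y V"
      "\<And>U x. openin Y U \<Longrightarrow> x \<in> U \<Longrightarrow> \<exists>V \<in> B. x \<in> V \<and> V \<subseteq> U"
    using sc unfolding second_countable_def by metis
  define T where "T n b = {x \<in> topspace X. \<exists>y\<in>b. (x, y) \<in> U n}" for n b
  have Ut: "U n \<subseteq> topspace X \<times> topspace Y" for n
    using U(1)[of n] openin_subset by (fastforce simp: dense_openin_def)
  have T: "dense_openin X (T n b)" if b: "openin Y b" "b \<noteq> {}" for n b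
    unfolding dense_openin_iff
  proof (intro conjI allI impI)
    have "openin (prod_topology X Y) (U n \<inter> (topspace X \<times> b))"
      using U(1)[of n] b by (intro openin_Int) (auto simp: dense_openin_def openin_prod_Times_iff)
    then have "openin X (fst ` (U n \<inter> (topspace X \<times> b)))"
      using open_map_fst by (auto simp: open_map_def)
    moreover have "fst ` (U n \<inter> (topspace X \<times> b)) = T n b"
      by (force simp: T_def)
    ultimately show "openin X (T n b)" by simp
  next
    fix V assume V: "openin X V \<and> V \<noteq> {}"
    have "openin (prod_topology X Y) (V \<times> b)" "V \<times> b \<noteq> {}"
      using V b by (auto simp: openin_prod_Times_iff)
    then have "U n \<inter> (V \<times> b) \<noteq> {}"
      using U(1)[of n] unfolding dense_openin_iff by blast
    then show "T n b \<inter> V \<noteq> {}" using V openin_subset by (fastforce simp: T_def)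
  qed
  show ?thesis
  proof (rule comeagre_in_countable[of "(\<lambda>(n, b). T n b) ` (UNIV \<times> (B - {{}}))"])
    show "countable ((\<lambda>(n, b). T n b) ` (UNIV \<times> (B - {{}})))"
      using B(1) by auto
    show "dense_openin X W" if "W \<in> (\<lambda>(n, b). T n b) ` (UNIV \<times> (B - {{}}))" for W
      using that T B(2) by auto
    show "topspace X \<inter> \<Inter> ((\<lambda>(n, b). T n b) ` (UNIV \<times> (B - {{}})))
        \<subseteq> {x \<in> topspace X. comeagre_in Y {y. (x, y) \<in> S}}"
    proof
      fix x assume x: "x \<in> topspace X \<inter> \<Inter> ((\<lambda>(n, b). T n b) ` (UNIV \<times> (B - {{}})))"
      then have xX: "x \<in> topspace X" and xT: "\<And>n b. b \<in> B \<Longrightarrow> b \<noteq> {} \<Longrightarrow> x \<in> T n b" by auto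
      have "comeagre_in Y {y. (x, y) \<in> S}"
      proof (rule comeagre_in_countable[of "range (\<lambda>n. {y \<in> topspace Y. (x, y) \<in> U n})"])
        fix W assume "W \<in> range (\<lambda>n. {y \<in> topspace Y. (x, y) \<in> U n})"
        then obtain n where W: "W = {y \<in> topspace Y. (x, y) \<in> U n}" by auto
        have "continuous_map Y (prod_topology X Y) (\<lambda>y. (x, y))"
          using xX by (auto simp: continuous_map_pairwise o_def)
        then have "openin Y W"
          unfolding W using U(1)[of n] by (auto simp: dense_openin_def intro:
            openin_continuous_map_preimage)
        moreover have "W \<inter> V \<noteq> {}" if V: "openin Y V" "V \<noteq> {}" for V
        proof -
          obtain b where b: "b \<in> B" "b \<subseteq> V" "b \<noteq> {}" using V B(3) by (metis empty_iff ex_in_conv)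
          then obtain y where "y \<in> b" "(x, y) \<in> U n" using xT[of b n] by (auto simp: T_def)
          then show ?thesis using b W V openin_subset by fastforce
        qed
        ultimately show "dense_openin Y W" by (auto simp: dense_openin_iff)
      next
        show "{y. (x, y) \<in> S} \<subseteq> topspace Y"
          using comeagre_in_subset_topspace[OF S] by auto
        show "topspace Y \<inter> \<Inter> (range (\<lambda>n. {y \<in> topspace Y. (x, y) \<in> U n})) \<subseteq> {y. (x, y) \<in> S}"
          using U(2) xX by auto
      qed auto
      then show "x \<in> {x \<in> topspace X. comeagre_in Y {y. (x, y) \<in> S}}" using xX by auto
    qed
  qed auto
qed

lemma (in Metric_space) separable_imp_second_countable:
  assumes "separable_space mtopology"
  shows "second_countable mtopology"
proof -
  obtain C where C: "countable C" "C \<subseteq> M" "mtopology closure_of C = M"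
    using assms by (auto simp: separable_space_def)
  define B where "B = (\<lambda>(c, n::nat). mball c (inverse (Suc n))) ` (C \<times> UNIV)"
  have "\<exists>V \<in> B. x \<in> V \<and> V \<subseteq> U" if U: "openin mtopology U" "x \<in> U" for U x
  proof -
    obtain r where r: "r > 0" "mball x r \<subseteq> U" and xM: "x \<in> M"
      using U by (meson openin_mtopology subsetD)
    obtain n where n: "inverse (Suc n) < r / 2"
      using r by (metis half_gt_zero reals_Archimedean)
    have "x \<in> mtopology closure_of C" using C xM by simp
    then have "\<forall>r>0. \<exists>c\<in>C. c \<in> mball x r"
      unfolding metric_closure_of by blast
    then have "0 < inverse (real (Suc n)) \<longrightarrow> (\<exists>c\<in>C. c \<in> mball x (inverse (Suc n)))" by (rule spec)
    then have "\<exists>c\<in>C. c \<in> mball x (inverse (Suc n))" by (rule mp) simp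
    then obtain c where c: "c \<in> C" "c \<in> mball x (inverse (Suc n))" by auto
    have "mball c (inverse (Suc n)) \<subseteq> mball x r"
    proof
      fix y assume y: "y \<in> mball c (inverse (Suc n))"
      then show "y \<in> mball x r"
        using c n triangle[of x c y] by (auto simp: in_mball)
    qed
    moreover have "x \<in> mball c (inverse (Suc n))" using c by (auto simp: in_mball commute)
    moreover have "mball c (inverse (Suc n)) \<in> B" using c(1) unfolding B_def
      by (intro image_eqI[of _ _ "(c, n)"]) auto
    ultimately show ?thesis using r(2) by blast
  qed
  moreover have "countable B" "\<forall>V\<in>B. openin mtopology V" using C(1) by (auto simp: B_def)
  ultimately show ?thesis unfolding second_countable_def by blast
qed

section \<open>Projections of closed sets and Mycielski's theorem\<close>

text \<open>The instance needed here of the Baire property of analytic sets; \<open>F\<close> below is a Souslin scheme.\<close>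

lemma (in Metric_space) closed_projection_comeagre:
  assumes complete: mcomplete and sep: "separable_space mtopology" and sc: "second_countable Y"
    and E: "closedin (prod_topology mtopology Y) E" and nm: "\<not> meagre_in Y (snd ` E)"
  obtains U where "openin Y U" "U \<noteq> {}" "meagre_in Y (U - snd ` E)"
proof -
  obtain C where C: "countable C" "C \<subseteq> M" "mtopology closure_of C = M"
    using sep by (auto simp: separable_space_def)
  have Esub: "E \<subseteq> M \<times> topspace Y"
    using closedin_subset[OF E] by simp
  have "C \<noteq> {}"
  proof
    assume "C = {}"
    then have "snd ` E = {}" using C Esub by auto
    with nm meagre_in_empty show False by metis
  qed
  then obtain q :: "nat \<Rightarrow> 'a" where q: "range q = C"
    using C(1) by (metis range_from_nat_into)
  have q_near: "\<exists>i. k \<in> mcball (q i) r" if "k \<in> M" "r > 0" for k r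
  proof -
    have "k \<in> mtopology closure_of C" using C that by simp
    then have "\<forall>r>0. \<exists>c\<in>C. c \<in> mball k r"
      unfolding metric_closure_of by blast
    then obtain c where "c \<in> C" "c \<in> mball k r" using \<open>r > 0\<close> by blast
    then show ?thesis using q by (force simp: commute)
  qed
  \<comment> \<open>Sequences carry the newest index at the head. Along a branch the radii are 1,
    1/2, 1/3, ..., so the closed sets \<open>F s\<close> shrink to a point.\<close>
  define F where "F = rec_list M (\<lambda>i (s::nat list) A. A \<inter> mcball (q i) (inverse (Suc (length s))))"
  have F_Nil: "F [] = M" and F_Cons: "F (i # s) = F s \<inter> mcball (q i) (inverse (Suc (length s)))"
    for i s
    by (simp_all add: F_def)
  have F_closed: "closedin mtopology (F s)" for s
    by (induction s) (auto simp: F_Nil F_Cons intro: closedin_Int)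
  have F_sub: "F s \<subseteq> M" for s
    using closedin_subset[OF F_closed] by simp
  have F_UN: "(\<Union>i. F (i # s)) = F s" for s
  proof -
    have "\<exists>i. k \<in> mcball (q i) (inverse (Suc (length s)))" if "k \<in> F s" for k
      using q_near that F_sub[of s] by (intro q_near) auto
    then show ?thesis unfolding F_Cons by blast
  qed
  define P where "P s = snd ` (E \<inter> (F s \<times> topspace Y))" for s
  have P_Nil: "P [] = snd ` E" using Esub by (auto simp: P_def F_Nil intro!: image_cong)
  have P_UN: "P s = (\<Union>i. P (i # s))" for s
    unfolding P_def by (subst F_UN[symmetric]) auto
  \<comment> \<open>\<open>W s\<close> becomes the largest open set in which \<open>P s\<close> is
    everywhere non-meagre. It stands in for the open set that the Baire property would attach to
    \<open>P s\<close>.\<close>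
  define loc where "loc s O' \<longleftrightarrow> openin Y O' \<and>
    (\<forall>V. openin Y V \<longrightarrow> V \<noteq> {} \<longrightarrow> V \<subseteq> O' \<longrightarrow> \<not> meagre_in Y (P s \<inter> V))" for s O'
  define W where "W s = \<Union>{O'. loc s O'}" for s
  have W_open: "openin Y (W s)" for s
    by (auto simp: W_def loc_def)
  have W_nm: "\<not> meagre_in Y (P s \<inter> V)" if V: "openin Y V" "V \<inter> W s \<noteq> {}" for s V
  proof
    assume m: "meagre_in Y (P s \<inter> V)"
    obtain O' where O': "loc s O'" "V \<inter> O' \<noteq> {}"
      using V(2) by (auto simp: W_def)
    have "\<not> meagre_in Y (P s \<inter> (V \<inter> O'))"
      using O' V(1) unfolding loc_def by (meson Int_lower2 openin_Int)
    moreover have "meagre_in Y (P s \<inter> (V \<inter> O'))"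
      by (rule meagre_in_subset[OF m]) auto
    ultimately show False by simp
  qed
  have W_intro: "W s \<inter> V \<noteq> {}" if V: "openin Y V" "\<not> meagre_in Y (P s \<inter> V)" for s V
  proof -
    obtain O' where O': "openin Y O'" "O' \<noteq> {}"
       "\<And>V'. openin Y V' \<Longrightarrow> V' \<noteq> {} \<Longrightarrow> V' \<subseteq> O' \<Longrightarrow> \<not> meagre_in Y (P s \<inter> V \<inter> V')"
      using not_meagre_in_localize[OF sc V(2)] by metis
    have "P s \<inter> V \<inter> O' \<noteq> {}"
      using O'(3)[OF O'(1,2) subset_refl] meagre_in_empty by metis
    moreover have "loc s (O' \<inter> V)"
      unfolding loc_def
    proof (intro conjI allI impI notI)
      show "openin Y (O' \<inter> V)" using O' V by auto
    next
      fix V' assume V': "openin Y V'" "V' \<noteq> {}" "V' \<subseteq> O' \<inter> V" "meagre_in Y (P s \<inter> V')"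
      have "meagre_in Y (P s \<inter> V \<inter> V')" by (rule meagre_in_subset[OF V'(4)]) auto
      with O'(3)[of V'] V' show False by auto
    qed
    ultimately show ?thesis by (auto simp: W_def)
  qed
  \<comment> \<open>\<open>P s\<close> is the countable union of the \<open>P (i # s)\<close>, so
    they cannot all be meagre where \<open>P s\<close> is not.\<close>
  have W_child: "\<exists>i. W (i # s) \<inter> V \<noteq> {}" if V: "openin Y V" "V \<inter> W s \<noteq> {}" for s V
  proof (rule ccontr)
    assume "\<nexists>i. W (i # s) \<inter> V \<noteq> {}"
    then have "meagre_in Y (P (i # s) \<inter> V)" for i using W_intro[OF V(1)] by blast
    then have "meagre_in Y (\<Union>i. P (i # s) \<inter> V)" by (intro meagre_in_UN) auto
    then have "meagre_in Y (P s \<inter> V)" by (rule meagre_in_subset) (auto simp: P_UN[of s])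
    then show False using W_nm[OF V] by simp
  qed
  \<comment> \<open>A point of \<open>W s\<close> that also lies in \<open>D s\<close> must lie in
    some \<open>W (i # s)\<close>: the second part of the union is disjoint from \<open>W s\<close>
    and only serves density.\<close>
  define D where "D s = (\<Union>i. W (i # s)) \<union> (topspace Y - Y closure_of W s)" for s
  have D: "dense_openin Y (D s)" for s
    unfolding dense_openin_iff
  proof (intro conjI allI impI)
    show "openin Y (D s)" unfolding D_def
      by (intro openin_Un openin_Union openin_diff) (use W_open in auto)
  next
    fix V assume V: "openin Y V \<and> V \<noteq> {}"
    show "D s \<inter> V \<noteq> {}"
    proof (cases "V \<inter> W s = {}")
      case True
      then have "V \<inter> Y closure_of W s = {}"
        using V by (simp add: openin_Int_closure_of_eq_empty)
      then show ?thesis using V openin_subset[of Y V] by (auto simp: D_def)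
    next
      case False
      then show ?thesis using W_child V by (fastforce simp: D_def)
    qed
  qed
  \<comment> \<open>Such a point descends along a branch \<open>st\<close>. Completeness gives a
    \<open>k\<close> in every \<open>F (st n)\<close>, and \<open>(k, x)\<close> is a limit of
    points of the closed set \<open>E\<close>.\<close>
  have key: "x \<in> snd ` E" if x: "x \<in> W []" "\<And>s. x \<in> D s" for x
  proof -
    have xY: "x \<in> topspace Y" using x(1) openin_subset[OF W_open] by auto
    have "\<exists>i. x \<in> W (i # s)" if "x \<in> W s" for s
      using x(2)[of s] that closure_of_subset[OF openin_subset[OF W_open[of s]]]
        by (auto simp: D_def)
    then obtain c where c: "\<And>s. x \<in> W s \<Longrightarrow> x \<in> W (c s # s)" by metis
    define st where "st = rec_nat [] (\<lambda>_ s. c s # s)"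
    have st0: "st 0 = []" and stS: "st (Suc n) = c (st n) # st n" for n by (simp_all add: st_def)
    have xW: "x \<in> W (st n)" for n
      by (induction n) (auto simp: st0 stS x c)
    have len: "length (st n) = n" for n by (induction n) (auto simp: st0 stS)
    \<comment> \<open>Every neighbourhood \<open>V\<close> of \<open>x\<close> contains points of
      the projection at every level of the branch, because \<open>x\<close> lies in
      \<open>W (st n)\<close>.\<close>
    have hit: "\<exists>k y. (k, y) \<in> E \<and> k \<in> F (st n) \<and> y \<in> V" if "openin Y V" "x \<in> V" for n V
    proof -
      have "\<not> meagre_in Y (P (st n) \<inter> V)" using W_nm[OF that(1)] that(2) xW by blast
      then have "P (st n) \<inter> V \<noteq> {}" using meagre_in_empty by metis
      then show ?thesis by (fastforce simp: P_def)
    qed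
    have dec: "decseq (\<lambda>n. F (st n))"
      by (rule decseq_SucI) (auto simp: stS F_Cons)
    have "\<Inter> (range (\<lambda>n. F (st n))) \<noteq> {}"
    proof (rule complete[unfolded mcomplete_nest, rule_format], intro conjI allI impI)
      show "F (st n) \<noteq> {}" for n using hit[OF openin_topspace xY, of n] by auto
      show "\<exists>n a. F (st n) \<subseteq> mcball a \<epsilon>" if \<epsilon>: "\<epsilon> > 0" for \<epsilon>
      proof -
        obtain n where n: "inverse (Suc n) < \<epsilon>" using \<epsilon> reals_Archimedean by blast
        have "F (st (Suc n)) \<subseteq> mcball (q (c (st n))) \<epsilon>"
          using n by (auto simp: stS F_Cons len)
        then show ?thesis by blast
      qed
    qed (use F_closed dec in auto)
    then obtain k where k: "\<And>n. k \<in> F (st n)" by auto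
    have kM: "k \<in> M" using k F_sub by blast
    have "(k, x) \<in> E"
    proof (rule ccontr)
      assume "(k, x) \<notin> E"
      then have "(k, x) \<in> topspace (prod_topology mtopology Y) - E" using kM xY by auto
      moreover have "openin (prod_topology mtopology Y) (topspace (prod_topology mtopology Y) - E)"
        using E by blast
      ultimately have "\<exists>A B. openin mtopology A \<and> openin Y B \<and> k \<in> A \<and> x \<in> B
          \<and> A \<times> B \<subseteq> topspace (prod_topology mtopology Y) - E"
        unfolding openin_prod_topology_alt by blast
      then obtain A B where AB: "openin mtopology A" "openin Y B" "k \<in> A" "x \<in> B" "A \<times> B \<inter> E = {}"
        by blast
      obtain r where r: "r > 0" "mball k r \<subseteq> A" using AB by (meson openin_mtopology)
      obtain n where n: "inverse (Suc n) < r / 2" using r by (meson half_gt_zero reals_Archimedean)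
      obtain k' y where ky: "(k', y) \<in> E" "k' \<in> F (st (Suc n))" "y \<in> B" using hit[OF AB(2,4)]
        by blast
      have "k' \<in> mball k r"
        using ky(2) k[of "Suc n"] n triangle[of k "q (c (st n))" k']
        by (auto simp: stS F_Cons len commute)
      then show False using r AB ky by blast
    qed
    then show ?thesis by force
  qed
  show thesis
  proof (rule that)
    show "openin Y (W [])" by (rule W_open)
    have "snd ` E \<subseteq> topspace Y" using Esub by auto
    then have "P [] \<inter> topspace Y = snd ` E" unfolding P_Nil by (rule Int_absorb2)
    then have "W [] \<inter> topspace Y \<noteq> {}"
      using nm by (intro W_intro openin_topspace) (simp only: not_False_eq_True)
    then show "W [] \<noteq> {}" by blast
    have "comeagre_in Y (topspace Y \<inter> (\<Inter>s\<in>UNIV. D s))"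
      by (intro comeagre_in_INT_countable dense_openin_imp_comeagre_in D) auto
    then show "meagre_in Y (W [] - snd ` E)"
      unfolding meagre_in_def by (rule comeagre_in_mono) (use key in auto)
  qed
qed

text \<open>The pairs are handled one by one. The open set \<open>D\<close> meets the box of the
  current pair and so contains a smaller box, which replaces the entries at \<open>s\<close> and
  \<open>t\<close>; these can be changed independently because \<open>s \<noteq> t\<close>. Further
  shrinking does no harm to pairs already handled.\<close>

lemma dense_openin_shrink:
  fixes V0 :: "'i \<Rightarrow> 'a set"
  assumes D: "dense_openin (prod_topology X X) D"
    and V0: "\<And>s. openin X (V0 s)" "\<And>s. V0 s \<noteq> {}"
    and P: "finite P" "\<And>s t. (s, t) \<in> P \<Longrightarrow> s \<noteq> t"
  shows "\<exists>V1. (\<forall>s. openin X (V1 s) \<and> V1 s \<noteq> {} \<and> V1 s \<subseteq> V0 s) \<and> (\<forall>(s, t)\<in>P. V1 s \<times> V1 t \<subseteq> D)"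
  using P
proof (induction P rule: finite_induct)
  case empty
  then show ?case using V0 by (intro exI[of _ V0]) auto
next
  case (insert p P)
  have "\<exists>V1. (\<forall>s. openin X (V1 s) \<and> V1 s \<noteq> {} \<and> V1 s \<subseteq> V0 s) \<and> (\<forall>(s, t)\<in>P. V1 s \<times> V1 t \<subseteq> D)"
    by (rule insert.IH) (use insert.prems in auto)
  then obtain V1 where V1': "\<forall>s. openin X (V1 s) \<and> V1 s \<noteq> {} \<and> V1 s \<subseteq> V0 s" "\<forall>(s, t)\<in>P. V1 s \<times> V1 t
      \<subseteq> D"
    by (elim exE conjE)
  have V1: "openin X (V1 s)" "V1 s \<noteq> {}" "V1 s \<subseteq> V0 s" "(s, t) \<in> P \<Longrightarrow> V1 s \<times> V1 t \<subseteq> D" for s t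
    using V1' by blast+
  obtain s t where p: "p = (s, t)" by (cases p)
  have st: "s \<noteq> t" using insert.prems p by auto
  have "openin (prod_topology X X) (V1 s \<times> V1 t)" "V1 s \<times> V1 t \<noteq> {}"
    using V1 by (auto simp: openin_prod_Times_iff)
  then have "openin (prod_topology X X) (D \<inter> V1 s \<times> V1 t)" "D \<inter> V1 s \<times> V1 t \<noteq> {}"
    using D by (auto simp: dense_openin_iff)
  then obtain x y where xy: "(x, y) \<in> D \<inter> V1 s \<times> V1 t" and o:
    "openin (prod_topology X X) (D \<inter> V1 s \<times> V1 t)"
    by auto
  then obtain A B where AB: "openin X A" "openin X B" "x \<in> A" "y \<in> B" "A \<times> B \<subseteq> D \<inter> V1 s \<times> V1 t"
    unfolding openin_prod_topology_alt by meson
  define V2 where "V2 = V1(s := A, t := B)"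
  have sub: "A \<subseteq> V1 s" "B \<subseteq> V1 t" using AB by auto
  have V2: "V2 u \<subseteq> V1 u" "openin X (V2 u)" "V2 u \<noteq> {}" for u
    using sub AB V1(1,2) by (auto simp: V2_def)
  have "V2 u \<times> V2 v \<subseteq> D" if "(u, v) \<in> insert p P" for u v
  proof (cases "(u, v) = p")
    case True
    then show ?thesis using p st AB by (auto simp: V2_def)
  next
    case False
    then show ?thesis using that V1(4)[of u v] V2(1)[of u] V2(1)[of v] by blast
  qed
  then show ?case using V2 V1(3) by (intro exI[of _ V2]) blast
qed

text \<open>A Cantor scheme of open sets with vanishing diameters. At each level the finitely many
  pairs of distinct nodes have their boxes pushed into the required dense open sets, and
  completeness turns branches into points.\<close>

lemma (in Metric_space) mycielski:
  assumes complete: mcomplete and ne: "M \<noteq> {}"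
    and U: "\<And>n::nat. dense_openin (prod_topology mtopology mtopology) (U n)"
  obtains h :: "(nat \<Rightarrow> bool) \<Rightarrow> 'a" where "\<And>a. h a \<in> M" "\<And>a b n. a \<noteq> b \<Longrightarrow> (h a, h b) \<in> U n"
proof -
  \<comment> \<open>Two branches may part only after level \<open>n\<close>, yet must satisfy the
    condition from \<open>U n\<close>. So each level treats all earlier sets as well.\<close>
  have fin: "dense_openin (prod_topology mtopology mtopology) (\<Inter>m\<le>n. U m)" for n
  proof (induction n)
    case 0
    then show ?case using U by simp
  next
    case (Suc n)
    have "dense_openin X (A \<inter> B)" if "dense_openin X A" "dense_openin X B"
      for X :: "('a \<times> 'a) topology" and A B
      using that unfolding dense_openin_iff by (metis Int_assoc openin_Int)
    then show ?case using Suc U by (simp add: atMost_Suc)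
  qed
  define Q where "Q n V \<longleftrightarrow> (\<forall>s::bool list. openin mtopology (V s) \<and> V s \<noteq> {})" for n :: nat and V
  define R where "R n V V' \<longleftrightarrow> (\<forall>i s. mtopology closure_of (V' (i # s)) \<subseteq> V s
      \<and> (\<exists>x. V' (i # s) \<subseteq> mcball x (inverse (Suc n))))
     \<and> (\<forall>s t. length s = Suc n \<longrightarrow> length t = Suc n \<longrightarrow> s \<noteq> t \<longrightarrow> V' s \<times> V' t \<subseteq> (\<Inter>m\<le>n. U m))"
    for n and V V' :: "bool list \<Rightarrow> 'a set"
  have "\<exists>V. \<forall>n. Q n (V n) \<and> R n (V n) (V (Suc n))"
  proof (rule dependent_nat_choice)
    show "\<exists>V. Q 0 V" using ne by (intro exI[of _ "\<lambda>_. M"]) (auto simp: Q_def)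
  next
    fix V n assume V: "Q n V"
    have "\<exists>W. openin mtopology W \<and> W \<noteq> {} \<and> mtopology closure_of W \<subseteq> V s
        \<and> (\<exists>x. W \<subseteq> mcball x (inverse (Suc n)))" for s
    proof -
      obtain x where x: "x \<in> V s" using V by (auto simp: Q_def)
      then obtain r where r: "r > 0" "mball x r \<subseteq> V s" "x \<in> M"
        using V unfolding Q_def by (meson openin_mtopology subsetD)
      \<comment> \<open>Halving \<open>r\<close> makes even the closed ball of radius
        \<open>r'\<close> fit into \<open>V s\<close>.\<close>
      define r' where "r' = min (r / 2) (inverse (Suc n))"
      have r': "r' > 0" "r' < r" "r' \<le> inverse (Suc n)" using r by (auto simp: r'_def)
      have "mtopology closure_of (mball x r') \<subseteq> mcball x r'"
        by (rule closure_of_minimal) auto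
      also have "\<dots> \<subseteq> V s" using r r' by force
      finally have "mtopology closure_of (mball x r') \<subseteq> V s" .
      moreover have "mball x r' \<subseteq> mcball x (inverse (Suc n))" using r'(3) by auto
      moreover have "x \<in> mball x r'" using r r' by simp
      ultimately show ?thesis by (intro exI[of _ "mball x r'"]) blast
    qed
    then obtain W where W: "\<And>s. openin mtopology (W s)" "\<And>s. W s \<noteq> {}"
      "\<And>s. mtopology closure_of (W s) \<subseteq> V s"
        "\<And>s. \<exists>x. W s \<subseteq> mcball x (inverse (Suc n))" by metis
    define P where "P = {(s, t). length s = Suc n \<and> length t = Suc n \<and> s \<noteq> (t::bool list)}"
    have "P \<subseteq> {s. length s = Suc n} \<times> {s. length s = Suc n}" by (auto simp: P_def)
    moreover have "finite {s::bool list. length s = Suc n}"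
      using finite_lists_length_eq[of "UNIV::bool set" "Suc n"] by simp
    ultimately have fP: "finite P" by (meson finite_SigmaI finite_subset)
    have Pne: "s \<noteq> t" if "(s, t) \<in> P" for s t using that by (simp add: P_def)
    \<comment> \<open>With the newest bit at the head, \<open>tl s\<close> is the parent of the node
      \<open>s\<close>.\<close>
    have "\<exists>V'. (\<forall>s. openin mtopology (V' s) \<and> V' s \<noteq> {} \<and> V' s \<subseteq> W (tl s))
        \<and> (\<forall>(s, t)\<in>P. V' s \<times> V' t \<subseteq> (\<Inter>m\<le>n. U m))"
      by (rule dense_openin_shrink[OF fin W(1,2) fP Pne])
    then obtain V' where V'1: "\<forall>s. openin mtopology (V' s) \<and> V' s \<noteq> {} \<and> V' s \<subseteq> W (tl s)"
        and V'2: "\<forall>(s, t)\<in>P. V' s \<times> V' t \<subseteq> (\<Inter>m\<le>n. U m)"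
      by (elim exE conjE)
    have V': "openin mtopology (V' s) \<and> V' s \<noteq> {} \<and> V' s \<subseteq> W (tl s)"
        "(s, t) \<in> P \<Longrightarrow> V' s \<times> V' t \<subseteq> (\<Inter>m\<le>n. U m)" for s t
      using V'1 V'2 by blast+
    have "R n V V'"
      unfolding R_def
    proof (intro conjI allI impI)
      fix i s
      have s: "V' (i # s) \<subseteq> W s" using V'(1)[of "i # s"] by simp
      show "mtopology closure_of (V' (i # s)) \<subseteq> V s" using closure_of_mono[OF s] W(3) by blast
      show "\<exists>x. V' (i # s) \<subseteq> mcball x (inverse (Suc n))" using s W(4)[of s] by blast
    qed (use V' in \<open>auto simp: P_def\<close>)
    moreover have "Q (Suc n) V'" using V' by (auto simp: Q_def)
    ultimately show "\<exists>V'. Q (Suc n) V' \<and> R n V V'" by blast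
  qed
  then obtain V where Q: "\<And>n. Q n (V n)" and R: "\<And>n. R n (V n) (V (Suc n))" by blast
  define br where "br (a :: nat \<Rightarrow> bool) = rec_nat [] (\<lambda>n s. a n # s)" for a
  have br0: "br a 0 = []" and brS: "br a (Suc n) = a n # br a n" for a n by (simp_all add: br_def)
  have len: "length (br a n) = n" for a n by (induction n) (auto simp: br0 brS)
  have br_eq: "a m = b m" if "br a n = br b n" "m < n" for a b m n
    using that by (induction n) (auto simp: br0 brS less_Suc_eq)
  define C where "C a n = mtopology closure_of (V n (br a n))" for a n
  have CV: "C a (Suc n) \<subseteq> V n (br a n)" for a n
    using R[of n] by (auto simp: R_def C_def brS)
  have VC: "V n (br a n) \<subseteq> C a n" for a n
    using Q[of n] unfolding C_def Q_def by (intro closure_of_subset openin_subset) auto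
  have "\<exists>x. x \<in> \<Inter> (range (C a))" for a
  proof -
    have "\<Inter> (range (C a)) \<noteq> {}"
    proof (rule complete[unfolded mcomplete_nest, rule_format], intro conjI allI impI)
      show "closedin mtopology (C a n)" for n by (simp add: C_def)
      show "C a n \<noteq> {}" for n using VC[of n a] Q[of n] by (auto simp: Q_def)
      show "decseq (C a)" by (rule decseq_SucI) (use CV VC in blast)
      show "\<exists>n x. C a n \<subseteq> mcball x \<epsilon>" if \<epsilon>: "\<epsilon> > 0" for \<epsilon>
      proof -
        obtain n where n: "inverse (Suc n) < \<epsilon>" using \<epsilon> reals_Archimedean by blast
        obtain x where "V (Suc n) (br a (Suc n)) \<subseteq> mcball x (inverse (Suc n))"
          using R[of n] unfolding R_def brS by metis
        then have "C a (Suc n) \<subseteq> mcball x (inverse (Suc n))"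
          unfolding C_def by (intro closure_of_minimal) auto
        moreover have "mcball x (inverse (Suc n)) \<subseteq> mcball x \<epsilon>" using n by auto
        ultimately show ?thesis by blast
      qed
    qed
    then show ?thesis by blast
  qed
  then obtain h where h: "\<And>a n. h a \<in> C a n" by (metis INT_D UNIV_I)
  have hV: "h a \<in> V n (br a n)" for a n using h CV by blast
  show thesis
  proof
    show "h a \<in> M" for a using h[of a 0] closure_of_subset_topspace unfolding C_def by fastforce
    fix a b :: "nat \<Rightarrow> bool" and n assume "a \<noteq> b"
    then obtain k where k: "a k \<noteq> b k" by auto
    \<comment> \<open>Level \<open>Suc m\<close> lies beyond the point where \<open>a\<close> and
      \<open>b\<close> differ and already includes the condition from \<open>U n\<close>.\<close>
    define m where "m = max k n"
    have "k < Suc m" by (simp add: m_def less_Suc_eq_le)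
    then have "br a (Suc m) \<noteq> br b (Suc m)" using br_eq k by metis
    then have "V (Suc m) (br a (Suc m)) \<times> V (Suc m) (br b (Suc m)) \<subseteq> (\<Inter>i\<le>m. U i)"
      using R[of m] len unfolding R_def by blast
    moreover have "n \<le> m" by (simp add: m_def)
    ultimately show "(h a, h b) \<in> U n" using hV by blast
  qed
qed

section \<open>Polish groups\<close>

text \<open>\<open>\<rho>\<close> is any complete metric for the Polish topology. It is not assumed
  invariant, so closeness of \<open>h\<close> and \<open>h \<otimes> f\<close> will be measured at
  the given \<open>h\<close>.\<close>

locale polish_group = group G + Metric_space "carrier G" \<rho>
  for G :: "('a, 'b) monoid_scheme" (structure) and \<rho> :: "'a \<Rightarrow> 'a \<Rightarrow> real" +
  assumes complete: mcomplete
    and separable: "separable_space mtopology"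
    and continuous_mult: "continuous_map (prod_topology mtopology mtopology) mtopology (\<lambda>(x, y). x
        \<otimes> y)"
    and continuous_inv: "continuous_map mtopology mtopology (\<lambda>x. inv x)"
begin

lemma second_countable: "second_countable mtopology"
  by (rule separable_imp_second_countable[OF separable])

lemma completely_metrizable: "completely_metrizable_space mtopology"
  using complete Metric_space_axioms by (auto simp: completely_metrizable_space_def)

lemma continuous_map_mult:
  assumes "continuous_map X mtopology f" "continuous_map X mtopology g"
  shows "continuous_map X mtopology (\<lambda>x. f x \<otimes> g x)"
proof -
  have "continuous_map X (prod_topology mtopology mtopology) (\<lambda>x. (f x, g x))"
    using assms by (simp add: continuous_map_pairedI)
  from continuous_map_compose[OF this continuous_mult] show ?thesis by (simp add: o_def)
qed

lemma continuous_map_inv: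
  assumes "continuous_map X mtopology f" shows "continuous_map X mtopology (\<lambda>x. inv (f x))"
  using continuous_map_compose[OF assms continuous_inv] by (simp add: o_def)

lemma continuous_map_const_carrier: "g \<in> carrier G \<Longrightarrow> continuous_map X mtopology (\<lambda>_. g)"
  by simp

lemmas continuous_group = continuous_map_mult continuous_map_inv continuous_map_const_carrier
  continuous_map_id[unfolded id_def] continuous_map_fst continuous_map_snd

lemma homeomorphic_mult_left:
  assumes "g \<in> carrier G" shows "homeomorphic_map mtopology mtopology (\<lambda>x. g \<otimes> x)"
proof -
  have "homeomorphic_maps mtopology mtopology (\<lambda>x. g \<otimes> x) (\<lambda>x. inv g \<otimes> x)"
    unfolding homeomorphic_maps_def
    by (intro conjI continuous_group ballI) (use assms in \<open>auto simp flip: m_assoc\<close>)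
  then show ?thesis using homeomorphic_maps_map by blast
qed

lemma homeomorphic_mult_right:
  assumes "g \<in> carrier G" shows "homeomorphic_map mtopology mtopology (\<lambda>x. x \<otimes> g)"
proof -
  have "homeomorphic_maps mtopology mtopology (\<lambda>x. x \<otimes> g) (\<lambda>x. x \<otimes> inv g)"
    unfolding homeomorphic_maps_def
    by (intro conjI continuous_group ballI) (use assms in \<open>auto simp: m_assoc\<close>)
  then show ?thesis using homeomorphic_maps_map by blast
qed

text \<open>If \<open>u \<otimes> g\<close> lies in \<open>U\<close>, then \<open>U\<close> and its
  right translate by \<open>g\<close> overlap in a non-empty open set. Outside a meagre set each
  \<open>x\<close> there satisfies both \<open>x \<in> S\<close> and
  \<open>x \<otimes> inv g \<in> S\<close>, and \<open>g\<close> is the quotient of these two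
  points.\<close>

lemma pettis:
  assumes U: "openin mtopology U" "U \<noteq> {}" and S: "meagre_in mtopology (U - S)"
  obtains V where "openin mtopology V" "\<one> \<in> V"
    "\<And>g. g \<in> V \<Longrightarrow> \<exists>s\<in>S \<inter> carrier G. \<exists>t\<in>S \<inter> carrier G. g = inv s \<otimes> t"
proof -
  have Uc: "U \<subseteq> carrier G" using openin_subset[OF U(1)] by simp
  obtain u where u: "u \<in> U" using U by auto
  have uc: "u \<in> carrier G" using u Uc by auto
  define V where "V = {g \<in> topspace mtopology. u \<otimes> g \<in> U}"
  have "openin mtopology V" unfolding V_def
    by (rule openin_continuous_map_preimage[OF _ U(1)]) (intro continuous_group uc)
  moreover have "\<one> \<in> V" using u uc by (simp add: V_def)
  moreover have "\<exists>s\<in>S \<inter> carrier G. \<exists>t\<in>S \<inter> carrier G. g = inv s \<otimes> t" if g: "g \<in> V" for g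
  proof -
    have gc: "g \<in> carrier G" and ug: "u \<otimes> g \<in> U" using g by (auto simp: V_def)
    define N where "N = U \<inter> {x \<in> topspace mtopology. x \<otimes> inv g \<in> U}"
    have "openin mtopology N" unfolding N_def
      by (intro openin_Int U openin_continuous_map_preimage[OF _ U(1)] continuous_group)
        (use gc in auto)
    moreover have "u \<otimes> g \<in> N" using ug u uc gc by (simp add: N_def m_assoc)
    ultimately have nm: "\<not> meagre_in mtopology N"
      using not_meagre_in_open[OF completely_metrizable] by auto
    have m: "meagre_in mtopology ((U - S) \<union> {x \<in> topspace mtopology. x \<otimes> inv g \<in> U - S})"
      by (intro meagre_in_Un S meagre_in_vimage[OF homeomorphic_mult_right]) (use gc in auto)
    have "\<not> N \<subseteq> (U - S) \<union> {x \<in> topspace mtopology. x \<otimes> inv g \<in> U - S}"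
      using meagre_in_subset[OF m, of N] nm by auto
    then obtain x where x: "x \<in> N" "x \<in> S" "x \<otimes> inv g \<in> S" by (auto simp: N_def)
    then have xc: "x \<in> carrier G" using Uc by (auto simp: N_def)
    have "g = inv (x \<otimes> inv g) \<otimes> x" using xc gc by (simp add: inv_mult_group m_assoc)
    then show ?thesis using x xc gc by blast
  qed
  ultimately show thesis using that by blast
qed

text \<open>The dense open sets avoiding \<open>A\<close> are pulled back along
  \<open>(x, y) \<mapsto> inv x \<otimes> y\<close>. The preimages remain dense because left
  translations are open.\<close>

lemma mycielski_group:
  assumes "meagre_in mtopology A"
  obtains h :: "(nat \<Rightarrow> bool) \<Rightarrow> 'a" where "\<And>a. h a \<in> carrier G" "\<And>a b. a \<noteq> b \<Longrightarrow> inv (h a) \<otimes> h b \<notin> A"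
proof -
  obtain D :: "nat \<Rightarrow> _" where D: "\<And>n. dense_openin mtopology (D n)" "carrier G \<inter> (\<Inter>n. D n)
      \<subseteq> carrier G - A"
    using assms by (auto simp: meagre_in_def comeagre_in_altdef)
  define U where "U n = {p \<in> topspace (prod_topology mtopology mtopology). inv (fst p) \<otimes> snd p
      \<in> D n}" for n
  have U: "dense_openin (prod_topology mtopology mtopology) (U n)" for n
    unfolding dense_openin_iff
  proof (intro conjI allI impI)
    show "openin (prod_topology mtopology mtopology) (U n)" unfolding U_def
      by (rule openin_continuous_map_preimage[of _ mtopology])
         (use D(1)[of n] in \<open>auto simp: dense_openin_def intro!: continuous_group\<close>)
  next
    fix W assume W: "openin (prod_topology mtopology mtopology) W \<and> W \<noteq> {}"
    then obtain x y where xy: "(x, y) \<in> W" by auto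
    then obtain A' B where AB: "openin mtopology A'" "openin mtopology B" "x \<in> A'" "y \<in> B"
      "A' \<times> B \<subseteq> W"
      using W unfolding openin_prod_topology_alt by meson
    have xc: "x \<in> carrier G" and Bc: "B \<subseteq> carrier G"
      using AB openin_subset[of mtopology A'] openin_subset[of mtopology B] by auto
    have "openin mtopology ((\<lambda>z. inv x \<otimes> z) ` B)"
      using homeomorphic_imp_open_map[OF homeomorphic_mult_left[of "inv x"]] AB xc
        by (auto simp: open_map_def)
    then obtain z where "z \<in> B" "inv x \<otimes> z \<in> D n"
      using D(1)[of n] AB unfolding dense_openin_iff by blast
    then show "U n \<inter> W \<noteq> {}" using AB xc Bc unfolding U_def by force
  qed
  have "carrier G \<noteq> {}" using one_closed by blast
  then obtain h :: "(nat \<Rightarrow> bool) \<Rightarrow> 'a" where h: "\<And>a. h a \<in> carrier G" "\<And>a b n. a \<noteq> b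
      \<Longrightarrow> (h a, h b) \<in> U n"
    by (rule mycielski[of U, OF complete _ U]) (rule that)
  show thesis
  proof
    fix a b :: "nat \<Rightarrow> bool" assume "a \<noteq> b"
    then have "inv (h a) \<otimes> h b \<in> D n" for n using h(2)[of a b n] by (simp add: U_def)
    then have "inv (h a) \<otimes> h b \<in> carrier G \<inter> (\<Inter>n. D n)" using h(1) by simp
    then show "inv (h a) \<otimes> h b \<notin> A" using D(2) by blast
  qed (use h in auto)
qed

end

text \<open>Choose for each \<open>h a\<close> a point of the dense set within \<open>q / 2\<close>.
  Separation by \<open>q\<close> makes this choice injective, so the dense set has at least the
  cardinality of Cantor space.\<close>

lemma (in group) graded_subgroup_index_separated:
  fixes h :: "(nat \<Rightarrow> bool) \<Rightarrow> 'a"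
  assumes H: "graded_subgroup G H" and idx: "index_lt_continuum G H"
    and h: "\<And>a. h a \<in> carrier G" and q: "q > 0"
    and sep: "\<And>a b. a \<noteq> b \<Longrightarrow> ennreal q \<le> H (inv (h a) \<otimes> h b)"
  shows False
proof -
  obtain D where D: "dH_dense G H D" "D \<prec> (UNIV :: real set)"
    using idx by (auto simp: index_lt_continuum_def)
  have "\<exists>x\<in>D. H (inv (h a) \<otimes> x) < ennreal (q / 2)" for a
    using D(1) h q by (auto simp: dH_dense_def)
  then obtain f where f: "\<And>a. f a \<in> D" "\<And>a. H (inv (h a) \<otimes> f a) < ennreal (q / 2)" by metis
  have fc: "f a \<in> carrier G" for a using f(1) D(1) by (auto simp: dH_dense_def)
  have "inj f"
  proof (rule injI, rule ccontr)
    fix a b assume eq: "f a = f b" and ne: "a \<noteq> b"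
    have "H (inv (f b) \<otimes> h b) = H (inv (inv (h b) \<otimes> f b))"
      using fc h by (simp add: inv_mult_group)
    also have "\<dots> = H (inv (h b) \<otimes> f b)"
      using H fc h by (auto simp: graded_subgroup_def)
    finally have b: "H (inv (f b) \<otimes> h b) < ennreal (q / 2)" using f(2) by simp
    have "f b \<otimes> (inv (f b) \<otimes> h b) = h b"
      using fc h by (simp add: m_assoc[symmetric])
    then have "H (inv (h a) \<otimes> h b) = H ((inv (h a) \<otimes> f a) \<otimes> (inv (f b) \<otimes> h b))"
      unfolding eq using fc h by (simp add: m_assoc)
    also have "\<dots> \<le> H (inv (h a) \<otimes> f a) + H (inv (f b) \<otimes> h b)"
      using H fc h by (auto simp: graded_subgroup_def)
    also have "\<dots> < ennreal (q / 2) + ennreal (q / 2)"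
      by (rule add_strict_mono[OF f(2) b])
    also have "\<dots> = ennreal q" using q by (simp flip: ennreal_plus)
    finally show False using sep[OF ne] by simp
  qed
  then have "(UNIV :: (nat \<Rightarrow> bool) set) \<lesssim> D"
    using f(1) by (auto simp: lepoll_def)
  \<comment> \<open>Characteristic functions relate Cantor space to the power set of
    \<open>nat\<close>, whose equipollence with the reals is available.\<close>
  moreover have "(UNIV :: nat set set) \<lesssim> (UNIV :: (nat \<Rightarrow> bool) set)"
    unfolding lepoll_def by (rule exI[of _ "\<lambda>A n. n \<in> A"]) (auto simp: inj_on_def fun_eq_iff)
  ultimately have "(UNIV :: real set) \<lesssim> D"
    using nat_sets_eqpoll_reals by (meson eqpoll_imp_lepoll eqpoll_sym lepoll_trans)
  then show False using D(2) lesspoll_def lepoll_antisym by blast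
qed

text \<open>If the sublevel set were meagre, Mycielski's theorem would give continuum many points at
  mutual distance at least \<open>q\<close>, too many for the index.\<close>

lemma (in polish_group) not_meagre_in_graded_sublevel:
  assumes H: "graded_subgroup G H" "index_lt_continuum G H" and q: "q > 0"
  shows "\<not> meagre_in mtopology {x \<in> carrier G. H x < ennreal q}"
proof
  assume "meagre_in mtopology {x \<in> carrier G. H x < ennreal q}"
  then obtain h :: "(nat \<Rightarrow> bool) \<Rightarrow> 'a" where h: "\<And>a. h a \<in> carrier G"
      "\<And>a b. a \<noteq> b \<Longrightarrow> inv (h a) \<otimes> h b \<notin> {x \<in> carrier G. H x < ennreal q}"
    using mycielski_group by blast
  have "ennreal q \<le> H (inv (h a) \<otimes> h b)" if "a \<noteq> b" for a b
    using h(1) h(2)[OF that] by (auto simp: not_less)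
  then show False by (rule graded_subgroup_index_separated[OF H h(1) q])
qed

section \<open>Generic tuples and conjugation\<close>

text \<open>Makes tuples of length \<open>n + 1\<close> accessible to the section theorem for pairs.
  In the inverse, \<open>restrict\<close> resets the value at \<open>n\<close> to
  \<open>undefined\<close>, since points of the product are extensional functions.\<close>

lemma homeomorphic_map_fun_upd:
  "homeomorphic_map (prod_topology (product_topology (\<lambda>_. X) {..<n}) X) (product_topology (\<lambda>_. X)
      {..<Suc n})
     (\<lambda>(x, y). x(n := y))"
proof -
  let ?P = "product_topology (\<lambda>_. X) {..<n}" and ?S = "product_topology (\<lambda>_. X) {..<Suc n}"
  have "homeomorphic_maps (prod_topology ?P X) ?S (\<lambda>(x, y). x(n := y)) (\<lambda>z. (restrict z {..<n}, z
      n))"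
    unfolding homeomorphic_maps_def
  proof (intro conjI ballI)
    show "continuous_map (prod_topology ?P X) ?S (\<lambda>(x, y). x(n := y))"
      unfolding continuous_map_componentwise
    proof (intro conjI ballI)
      show "(\<lambda>(x, y). x(n := y)) ` topspace (prod_topology ?P X) \<subseteq> extensional {..<Suc n}"
        by (auto simp: extensional_def PiE_def)
      fix k assume k: "k \<in> {..<Suc n}"
      show "continuous_map (prod_topology ?P X) X (\<lambda>p. (case p of (x, y) \<Rightarrow> x(n := y)) k)"
      proof (cases "k = n")
        case True
        then show ?thesis by (simp add: case_prod_beta continuous_map_snd)
      next
        case False
        then have "k \<in> {..<n}" using k by auto
        then have "continuous_map (prod_topology ?P X) X ((\<lambda>x. x k) \<circ> fst)"
          by (intro continuous_map_compose[OF continuous_map_fst] continuous_map_product_projection)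
        then show ?thesis using False by (simp add: case_prod_beta o_def)
      qed
    qed
    have "continuous_map ?S ?P (\<lambda>z. restrict z {..<n})"
      unfolding continuous_map_componentwise
      by (auto simp: intro!: continuous_map_product_projection)
    moreover have "continuous_map ?S X (\<lambda>z. z n)"
      by (intro continuous_map_product_projection) auto
    ultimately show "continuous_map ?S (prod_topology ?P X) (\<lambda>z. (restrict z {..<n}, z n))"
      by (rule continuous_map_pairedI)
  next
    fix p assume "p \<in> topspace (prod_topology ?P X)"
    then show "(\<lambda>z. (restrict z {..<n}, z n)) (case p of (x, y) \<Rightarrow> x(n := y)) = p"
      by (auto simp: fun_eq_iff PiE_def extensional_def)
  next
    fix z assume "z \<in> topspace ?S"
    then show "(case (restrict z {..<n}, z n) of (x, y) \<Rightarrow> x(n := y)) = z"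
      by (auto simp: fun_eq_iff PiE_def extensional_def)
  qed
  then show ?thesis using homeomorphic_maps_map by blast
qed

lemma comeagre_in_product_section:
  assumes "second_countable X" "comeagre_in (product_topology (\<lambda>_. X) {..<Suc n}) S"
  shows "comeagre_in (product_topology (\<lambda>_. X) {..<n})
     {x \<in> {..<n} \<rightarrow>\<^sub>E topspace X. comeagre_in X {y \<in> topspace X. x(n := y) \<in> S}}"
proof -
  have "comeagre_in (product_topology (\<lambda>_. X) {..<n}) {x \<in> topspace (product_topology (\<lambda>_. X)
      {..<n}).
     comeagre_in X {y. (x, y) \<in> {p \<in> topspace (prod_topology (product_topology (\<lambda>_. X) {..<n}) X).
       (case p of (x, y) \<Rightarrow> x(n := y)) \<in> S}}}"
    by (rule comeagre_in_section[OF assms(1) comeagre_in_vimage[OF homeomorphic_map_fun_upd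
      assms(2)]])
  then show ?thesis
    by (rule back_subst[of "comeagre_in _"]) (auto cong: conj_cong)
qed

text \<open>Tuples lying in \<open>iterated_section X Q m n\<close> for all \<open>m\<close> can be extended generically
  infinitely often.\<close>

primrec iterated_section :: "'a topology \<Rightarrow> (nat \<Rightarrow> (nat \<Rightarrow> 'a) set) \<Rightarrow> nat \<Rightarrow> nat \<Rightarrow> (nat
    \<Rightarrow> 'a) set" where
  "iterated_section X Q 0 n = Q n"
| "iterated_section X Q (Suc m) n =
     {x \<in> {..<n} \<rightarrow>\<^sub>E topspace X. comeagre_in X {y \<in> topspace X. x(n := y) \<in> iterated_section X Q m
       (Suc n)}}"

text \<open>\<open>R n\<close> is the intersection of \<open>iterated_section X Q m n\<close> over
  all \<open>m\<close>. A point \<open>x\<close> of it satisfies the condition at every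
  \<open>Suc m\<close>, so its good extensions form a countable intersection of comeagre sets, and
  they land in \<open>R (Suc n)\<close> itself.\<close>

lemma hereditarily_comeagre:
  assumes sc: "second_countable X"
    and Q: "\<And>n. comeagre_in (product_topology (\<lambda>_. X) {..<n}) (Q n)"
  obtains R where "\<And>n. R n \<subseteq> Q n" "(\<lambda>_. undefined) \<in> R 0"
    "\<And>n x. x \<in> R n \<Longrightarrow> comeagre_in X {y \<in> topspace X. x(n := y) \<in> R (Suc n)}"
proof
  let ?I = "iterated_section X Q"
  have c: "comeagre_in (product_topology (\<lambda>_. X) {..<n}) (?I m n)" for m n
  proof (induction m arbitrary: n)
    case (Suc m)
    show ?case unfolding iterated_section.simps by (rule comeagre_in_product_section[OF sc Suc])
  qed (simp add: Q)
  define R where "R n = (\<Inter>m. ?I m n)" for n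
  show "R n \<subseteq> Q n" for n
    unfolding R_def using iterated_section.simps(1) by blast
  show "(\<lambda>_. undefined) \<in> R 0"
  proof -
    \<comment> \<open>The empty product is a single point, so every dense open set contains it and
      only the whole space is comeagre.\<close>
    let ?T = "product_topology (\<lambda>_. X) {..<0::nat}"
    have T: "topspace ?T = {\<lambda>_. undefined}" by simp
    have cR: "comeagre_in ?T (R 0)" unfolding R_def by (intro comeagre_in_INT c)
    then obtain U :: "nat \<Rightarrow> _" where U: "\<And>n. dense_openin ?T (U n)" "topspace ?T \<inter> (\<Inter>n. U n) \<subseteq> R 0"
      unfolding comeagre_in_altdef by blast
    have "(\<lambda>_. undefined) \<in> U n" for n
    proof -
      have "U n \<inter> topspace ?T \<noteq> {}"
        using U(1)[of n] T unfolding dense_openin_iff by (metis insert_not_empty openin_topspace)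
      then show ?thesis using T by auto
    qed
    then show ?thesis using U(2) T by blast
  qed
  fix n x assume x: "x \<in> R n"
  have "comeagre_in X {y \<in> topspace X. x(n := y) \<in> ?I m (Suc n)}" for m
  proof -
    have "x \<in> ?I (Suc m) n" using x unfolding R_def by blast
    then show ?thesis by simp
  qed
  then have "comeagre_in X (\<Inter>m. {y \<in> topspace X. x(n := y) \<in> ?I m (Suc n)})"
    by (rule comeagre_in_INT)
  moreover have "(\<Inter>m. {y \<in> topspace X. x(n := y) \<in> ?I m (Suc n)}) = {y \<in> topspace X. x(n := y)
      \<in> R (Suc n)}"
    unfolding R_def by auto
  ultimately show "comeagre_in X {y \<in> topspace X. x(n := y) \<in> R (Suc n)}" by simp
qed

section \<open>Bi-invariant metrics and approximate conjugacy of tuples\<close>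

locale biinvariant_polish_group = polish_group G \<rho> + D: Metric_space "carrier G" d
  for G :: "('a, 'b) monoid_scheme" (structure) and \<rho> d :: "'a \<Rightarrow> 'a \<Rightarrow> real" +
  assumes d_mult_left: "\<lbrakk>k \<in> carrier G; x \<in> carrier G; y \<in> carrier G\<rbrakk> \<Longrightarrow> d (k \<otimes> x) (k \<otimes> y) = d x y"
    and d_mult_right: "\<lbrakk>k \<in> carrier G; x \<in> carrier G; y \<in> carrier G\<rbrakk> \<Longrightarrow> d (x \<otimes> k) (y \<otimes> k) = d x y"
    and closedin_d_le: "closedin (prod_topology mtopology mtopology) {(g, h) \<in> carrier G
        \<times> carrier G. d g h \<le> r}"
begin

definition conjugate :: "'a \<Rightarrow> 'a \<Rightarrow> 'a" where "conjugate k x = k \<otimes> x \<otimes> inv k"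

lemma conjugate_closed [simp]: "k \<in> carrier G \<Longrightarrow> x \<in> carrier G \<Longrightarrow> conjugate k x \<in> carrier G"
  by (simp add: conjugate_def)

lemma conjugate_mult:
  "\<lbrakk>k \<in> carrier G; l \<in> carrier G; x \<in> carrier G\<rbrakk> \<Longrightarrow> conjugate (k \<otimes> l) x = conjugate k (conjugate l
      x)"
  by (simp add: conjugate_def m_assoc inv_mult_group)

lemma conjugate_one [simp]: "x \<in> carrier G \<Longrightarrow> conjugate \<one> x = x"
  by (simp add: conjugate_def)

lemma d_conjugate:
  "\<lbrakk>k \<in> carrier G; x \<in> carrier G; y \<in> carrier G\<rbrakk> \<Longrightarrow> d (conjugate k x) (conjugate k y) = d x y"
  by (simp add: conjugate_def d_mult_left d_mult_right)

text \<open>On the right each point is pulled back by its own conjugator, so both can be compared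
  with a common \<open>g i\<close>.\<close>

lemma d_conjugate_mult_inv:
  assumes "k \<in> carrier G" "l \<in> carrier G" "x \<in> carrier G" "y \<in> carrier G"
  shows "d (conjugate (k \<otimes> inv l) x) y = d (conjugate (inv l) x) (conjugate (inv k) y)"
proof -
  have "y = conjugate k (conjugate (inv k) y)" using assms by (simp flip: conjugate_mult)
  then have "d (conjugate (k \<otimes> inv l) x) y = d (conjugate k (conjugate (inv l) x)) (conjugate k
      (conjugate (inv k) y))"
    using assms by (simp add: conjugate_mult)
  then show ?thesis using assms by (simp add: d_conjugate)
qed

lemma continuous_map_conjugate:
  assumes "continuous_map X mtopology f" "continuous_map X mtopology g"
  shows "continuous_map X mtopology (\<lambda>p. conjugate (f p) (g p))"
  unfolding conjugate_def by (intro continuous_group assms)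

text \<open>Carrier of the lower semi-continuity of \<open>d\<close>: it gives the closed sets
  \<open>E\<close> of approximate conjugacies and lets \<open>d\<close>-estimates pass to limits of
  conjugators.\<close>

lemma closedin_d_le_preimage:
  assumes "continuous_map X mtopology f" "continuous_map X mtopology g"
  shows "closedin X {p \<in> topspace X. d (f p) (g p) \<le> r}"
proof -
  have "closedin X {p \<in> topspace X. (f p, g p) \<in> {(g, h) \<in> carrier G \<times> carrier G. d g h \<le> r}}"
    by (rule closedin_continuous_map_preimage[OF _ closedin_d_le])
      (intro continuous_map_pairedI assms)
  moreover have "f p \<in> carrier G \<and> g p \<in> carrier G" if "p \<in> topspace X" for p
    using assms that by (auto simp: continuous_map_def)
  ultimately show ?thesis by (auto elim!: back_subst[of "closedin X"])
qed

text \<open>A substitute for Effros' theorem: the fibre over one of countably many small pieces of the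
  group is
  non-meagre, hence comeagre in some open set, and thus meets both \<open>A\<close> and \<open>B\<close>.\<close>

lemma generic_extension:
  assumes g: "g \<in> {..<Suc n} \<rightarrow>\<^sub>E carrier G" and x: "x \<in> {..<n} \<rightarrow> carrier G" and h: "h \<in> carrier G"
    and C: "comeagre_in mtopology C" "\<And>y. y \<in> C \<Longrightarrow> x(n := y) \<in> orbit_dclosure G d (Suc n) g"
    and A: "\<not> meagre_in mtopology A"
    and B: "\<And>U. openin mtopology U \<Longrightarrow> U \<noteq> {} \<Longrightarrow> \<not> meagre_in mtopology (B \<inter> U)"
    and eps: "\<epsilon> > 0" and eta: "\<eta> > 0"
  obtains y0 y1 f where "y0 \<in> A \<inter> C" "y1 \<in> B \<inter> C" "f \<in> carrier G" "\<rho> h (h \<otimes> f) < \<eta>"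
    "\<And>i. i < n \<Longrightarrow> d (conjugate f (x i)) (x i) < \<epsilon>" "d (conjugate f y1) y0 < \<epsilon>"
proof -
  \<comment> \<open>Two non-strict errors of \<open>\<epsilon> / 3\<close> add up to strictly less
    than \<open>\<epsilon>\<close>.\<close>
  define \<epsilon>' where "\<epsilon>' = \<epsilon> / 3"
  have eps': "\<epsilon>' > 0" "\<epsilon>' + \<epsilon>' < \<epsilon>" using eps by (auto simp: \<epsilon>'_def)
  have Cc: "C \<subseteq> carrier G" using comeagre_in_subset_topspace[OF C(1)] by simp
  have gc: "g i \<in> carrier G" if "i \<le> n" for i using g that by (auto simp: PiE_iff)
  have xc: "x i \<in> carrier G" if "i < n" for i using x that by auto
  obtain Z where Z: "countable Z" "Z \<subseteq> carrier G" "mtopology closure_of Z = carrier G"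
    using separable by (auto simp: separable_space_def)
  \<comment> \<open>Indices of the pieces: small closed balls in which any quotient
    \<open>k \<otimes> inv l\<close> moves \<open>h\<close> by less than \<open>\<eta>\<close>. They
    cover the group because \<open>h \<otimes> (k \<otimes> inv l)\<close> is continuous and equals
    \<open>h\<close> on the diagonal.\<close>
  define I where "I = {(c, m::nat). c \<in> Z \<and>
     (\<forall>k\<in>mcball c (inverse (Suc m)). \<forall>l\<in>mcball c (inverse (Suc m)). \<rho> h (h \<otimes> (k \<otimes> inv l)) < \<eta>)}"
  have "I \<subseteq> Z \<times> UNIV" by (auto simp: I_def)
  then have I_countable: "countable I" using Z(1)
    by (meson countable_SIGMA countable_subset countableI_type)
  have cover: "\<exists>(c, m)\<in>I. k \<in> mcball c (inverse (Suc m))" if k: "k \<in> carrier G" for k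
  proof -
    define W where "W = {p \<in> topspace (prod_topology mtopology mtopology). h \<otimes> (fst p \<otimes> inv (snd p))
        \<in> mball h \<eta>}"
    have "openin (prod_topology mtopology mtopology) W" unfolding W_def
      by (rule openin_continuous_map_preimage[OF _ openin_mball]) (intro continuous_group h)
    moreover have "(k, k) \<in> W" using k h eta by (simp add: W_def)
    ultimately obtain N1 N2 where N: "openin mtopology N1" "openin mtopology N2" "k \<in> N1" "k \<in> N2"
      "N1 \<times> N2 \<subseteq> W"
      unfolding openin_prod_topology_alt by meson
    have "openin mtopology (N1 \<inter> N2)" "k \<in> N1 \<inter> N2" using N by auto
    then obtain r where r: "r > 0" "mball k r \<subseteq> N1 \<inter> N2" by (meson openin_mtopology)
    obtain m where m: "inverse (Suc m) < r / 2" using r by (meson half_gt_zero reals_Archimedean)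
    have "k \<in> mtopology closure_of Z" using Z k by simp
    then have "\<forall>r>0. \<exists>c\<in>Z. c \<in> mball k r"
      unfolding metric_closure_of by blast
    then have "0 < inverse (real (Suc m)) \<longrightarrow> (\<exists>c\<in>Z. c \<in> mball k (inverse (Suc m)))" by (rule spec)
    then obtain c where c: "c \<in> Z" "c \<in> mball k (inverse (Suc m))" by auto
    have "l \<in> N1 \<inter> N2" if "l \<in> mcball c (inverse (Suc m))" for l
    proof -
      have "l \<in> mball k r" using that c m triangle[of k c l] by simp
      then show ?thesis using r by blast
    qed
    then have "(l, l') \<in> W" if "l \<in> mcball c (inverse (Suc m))" "l' \<in> mcball c (inverse (Suc m))"
      for l l'
      using N(5) that by blast
    then have "(c, m) \<in> I" using c by (auto simp: I_def W_def)
    moreover have "k \<in> mcball c (inverse (Suc m))" using c by (simp add: commute)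
    ultimately show ?thesis by blast
  qed
  \<comment> \<open>Pairs \<open>(k, y)\<close> with \<open>k\<close> in the given piece that
    conjugates \<open>g\<close> to the tuple \<open>x\<close> extended by \<open>y\<close>, up to
    \<open>\<epsilon>'\<close>.\<close>
  define E where "E = (\<lambda>(c, m::nat). {p \<in> topspace (prod_topology mtopology mtopology). fst p
      \<in> mcball c (inverse (Suc m))} \<inter>
     (\<Inter>i\<in>{..n}. {p \<in> topspace (prod_topology mtopology mtopology). d (conjugate (fst p) (g i))
       ((if i = n then snd p else x i)) \<le> \<epsilon>'}))"
  have E_closed: "closedin (prod_topology mtopology mtopology) (E j)" for j
  proof -
    obtain c m where j: "j = (c, m)" by (cases j)
    have 1: "closedin (prod_topology mtopology mtopology) {p \<in> topspace (prod_topology mtopology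
        mtopology). d (conjugate (fst p) (g i)) ((if i = n then snd p else x i)) \<le> \<epsilon>'}"
      if "i \<le> n" for i
      by (rule closedin_d_le_preimage)
         (cases "i = n"; use that gc xc in \<open>auto intro!: continuous_map_conjugate
           continuous_group\<close>)+
    have 2: "closedin (prod_topology mtopology mtopology) {p \<in> topspace (prod_topology mtopology
        mtopology). fst p \<in> mcball c (inverse (Suc m))}"
      by (rule closedin_continuous_map_preimage[OF continuous_map_fst]) simp
    show ?thesis unfolding E_def j prod.case by (intro closedin_Int closedin_INT 1 2) auto
  qed
  have E_iff: "(k, y) \<in> E (c, m) \<longleftrightarrow> k \<in> carrier G \<and> y \<in> carrier G \<and> k \<in> mcball c (inverse (Suc m))
      \<and> (\<forall>i\<le>n. d (conjugate k (g i)) (if i = n then y else x i) \<le> \<epsilon>')" for k y c m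
    by (auto simp: E_def split del: if_split cong del: if_weak_cong)
  have C_cover: "C \<subseteq> (\<Union>j\<in>I. snd ` E j)"
  proof
    fix y assume y: "y \<in> C"
    then have "x(n := y) \<in> orbit_dclosure G d (Suc n) g" by (rule C(2))
    then obtain k where k: "k \<in> carrier G" "\<And>i. i < Suc n
        \<Longrightarrow> d ((x(n := y)) i) (k \<otimes> g i \<otimes> inv k) < \<epsilon>'"
      using eps' unfolding orbit_dclosure_def by blast
    obtain c m where cm: "(c, m) \<in> I" "k \<in> mcball c (inverse (Suc m))" using cover[OF k(1)] by auto
    have "d (conjugate k (g i)) (if i = n then y else x i) \<le> \<epsilon>'" if "i \<le> n" for i
      using k(2)[of i] that unfolding conjugate_def by (cases "i = n") (auto simp: D.commute)
    then have "(k, y) \<in> E (c, m)"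
      using cm(2) k(1) y Cc unfolding E_iff by blast
    then show "y \<in> (\<Union>j\<in>I. snd ` E j)" using cm(1) by force
  qed
  \<comment> \<open>The countably many fibres cover \<open>C\<close>, so one of them has a
    non-meagre part in \<open>A\<close>. Its index \<open>j\<close> serves for both
    \<open>y0\<close> and \<open>y1\<close>.\<close>
  have "\<exists>j\<in>I. \<not> meagre_in mtopology (A \<inter> C \<inter> snd ` E j)"
  proof (rule ccontr)
    assume "\<not> (\<exists>j\<in>I. \<not> meagre_in mtopology (A \<inter> C \<inter> snd ` E j))"
    then have "meagre_in mtopology (\<Union>j\<in>I. A \<inter> C \<inter> snd ` E j)"
      by (intro meagre_in_UN I_countable) auto
    then have "meagre_in mtopology (A \<inter> C)" by (rule meagre_in_subset) (use C_cover in blast)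
    then show False using not_meagre_in_Int_comeagre_in[OF A C(1)] by blast
  qed
  then obtain j where j: "j \<in> I" "\<not> meagre_in mtopology (A \<inter> C \<inter> snd ` E j)" by blast
  then obtain y0 where y0: "y0 \<in> A \<inter> C \<inter> snd ` E j" using meagre_in_empty by (metis ex_in_conv)
  have "\<not> meagre_in mtopology (snd ` E j)" using j(2) meagre_in_subset by blast
  then obtain U where U: "openin mtopology U" "U \<noteq> {}" "meagre_in mtopology (U - snd ` E j)"
    using closed_projection_comeagre[OF complete separable second_countable E_closed] by blast
  \<comment> \<open>The fibre is comeagre in \<open>U\<close> while \<open>B\<close> is non-meagre
    there, so \<open>y1\<close> can be taken over the same piece as \<open>y0\<close>.\<close>
  have "\<not> meagre_in mtopology (B \<inter> U \<inter> C)"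
    by (rule not_meagre_in_Int_comeagre_in[OF B[OF U(1,2)] C(1)])
  then have "\<not> B \<inter> U \<inter> C \<subseteq> U - snd ` E j" using meagre_in_subset[OF U(3)] by blast
  then obtain y1 where y1: "y1 \<in> B \<inter> C \<inter> snd ` E j" by blast
  obtain c m where cm: "j = (c, m)" by (cases j)
  obtain k0 where k0: "(k0, y0) \<in> E j" using y0 by auto
  obtain k1 where k1: "(k1, y1) \<in> E j" using y1 by auto
  have kc: "k0 \<in> carrier G" "k1 \<in> carrier G" and yc: "y0 \<in> carrier G" "y1 \<in> carrier G"
    using k0 k1 unfolding cm E_iff by blast+
  have d0: "d (conjugate k0 (g i)) (if i = n then y0 else x i) \<le> \<epsilon>'" if "i \<le> n" for i
    using k0 that unfolding cm E_iff by blast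
  have d1: "d (conjugate k1 (g i)) (if i = n then y1 else x i) \<le> \<epsilon>'" if "i \<le> n" for i
    using k1 that unfolding cm E_iff by blast
  \<comment> \<open>The conjugator is \<open>k0 \<otimes> inv k1\<close>: both \<open>k0\<close> and
    \<open>k1\<close> start from \<open>g\<close>, so going back with \<open>k1\<close> and forth
    with \<open>k0\<close> costs two errors.\<close>
  have main: "d (conjugate (k0 \<otimes> inv k1) v) u < \<epsilon>"
    if "i \<le> n" "u \<in> carrier G" "v \<in> carrier G" "d (conjugate k0 (g i)) u \<le> \<epsilon>'"
      "d (conjugate k1 (g i)) v \<le> \<epsilon>'" for i u v
  proof -
    have *: "d (conjugate (inv k) w) (g i) = d (conjugate k (g i)) w" if "k \<in> carrier G"
      "w \<in> carrier G" for k w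
    proof -
      have "d (conjugate k (conjugate (inv k) w)) (conjugate k (g i)) = d (conjugate (inv k) w) (g
          i)"
        using that gc[OF \<open>i \<le> n\<close>] by (intro d_conjugate) auto
      moreover have "conjugate k (conjugate (inv k) w) = w" using that
        by (simp flip: conjugate_mult)
      ultimately show ?thesis by (simp add: D.commute)
    qed
    have "d (conjugate (k0 \<otimes> inv k1) v) u = d (conjugate (inv k1) v) (conjugate (inv k0) u)"
      using that kc by (intro d_conjugate_mult_inv) auto
    also have "\<dots> \<le> d (conjugate (inv k1) v) (g i) + d (g i) (conjugate (inv k0) u)"
      using that kc gc by (intro D.triangle) auto
    also have "\<dots> \<le> \<epsilon>' + \<epsilon>'"
      using that kc * by (intro add_mono) (auto simp: D.commute)
    finally show ?thesis using eps' by simp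
  qed
  show thesis
  proof
    show "y0 \<in> A \<inter> C" "y1 \<in> B \<inter> C" using y0 y1 by auto
    show "k0 \<otimes> inv k1 \<in> carrier G" using kc by simp
    show "\<rho> h (h \<otimes> (k0 \<otimes> inv k1)) < \<eta>"
      using j(1) k0 k1 unfolding cm E_iff I_def by blast
    show "d (conjugate (k0 \<otimes> inv k1) (x i)) (x i) < \<epsilon>" if "i < n" for i
      using main[of i "x i" "x i"] d0[of i] d1[of i] that xc by auto
    show "d (conjugate (k0 \<otimes> inv k1) y1) y0 < \<epsilon>"
      using main[of n y0 y1] d0[of n] d1[of n] yc by auto
  qed
qed

end

section \<open>The tree of conjugators\<close>

context biinvariant_polish_group begin

text \<open>Separates the tree from category arguments. The powers of 1/2 make the group elements
  along a branch Cauchy for \<open>\<rho>\<close> and bound the total \<open>d\<close>-error of a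
  branch by \<open>\<delta>\<close>; comparing two branches gives
  \<open>2 * \<delta>\<close>.\<close>

lemma separated_family_of_step:
  assumes step: "\<And>n x h. x \<in> R n \<Longrightarrow> h \<in> carrier G \<Longrightarrow>
      \<exists>y0 y1 f. y0 \<in> A \<and> y1 \<in> B \<and> x(n := y0) \<in> R (Suc n) \<and> x(n := y1) \<in> R (Suc n) \<and> f \<in> carrier G
        \<and> \<rho> h (h \<otimes> f) < (1 / 2) ^ n \<and> (\<forall>i<n. d (conjugate f (x i)) (x i) < \<delta> * (1 / 2) ^ Suc n)
        \<and> d (conjugate f y1) y0 < \<delta> * (1 / 2) ^ Suc n"
    and R: "(\<lambda>_. undefined) \<in> R 0" "\<And>n. R n \<subseteq> {..<n} \<rightarrow>\<^sub>E carrier G" and \<delta>: "\<delta> > 0"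
  obtains h :: "(nat \<Rightarrow> bool) \<Rightarrow> 'a" where "\<And>a. h a \<in> carrier G"
    "\<And>a b. a \<noteq> b \<Longrightarrow> \<exists>y0\<in>A \<inter> carrier G. \<exists>y1\<in>B \<inter> carrier G.
        d (conjugate (h a) y1) (conjugate (h b) y0) \<le> 2 * \<delta> \<or> d (conjugate (h b) y1) (conjugate
          (h a) y0) \<le> 2 * \<delta>"
proof -
  define S where "S n x h y0 y1 f \<longleftrightarrow> y0 \<in> A \<and> y1 \<in> B \<and> x(n := y0) \<in> R (Suc n)
      \<and> x(n := y1) \<in> R (Suc n) \<and> f \<in> carrier G
        \<and> \<rho> h (h \<otimes> f) < (1 / 2) ^ n \<and> (\<forall>i<n. d (conjugate f (x i)) (x i) < \<delta> * (1 / 2) ^ Suc n)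
        \<and> d (conjugate f y1) y0 < \<delta> * (1 / 2) ^ Suc n" for n x h y0 y1 f
  have "\<forall>n x h. \<exists>y0 y1 f. x \<in> R n \<longrightarrow> h \<in> carrier G \<longrightarrow> S n x h y0 y1 f"
    using step unfolding S_def by blast
  then obtain Y0 Y1 F where step': "\<And>n x h. x \<in> R n \<Longrightarrow> h \<in> carrier G
      \<Longrightarrow> S n x h (Y0 n x h) (Y1 n x h) (F n x h)"
    by metis
  \<comment> \<open>Bit 0 appends \<open>y0\<close> and keeps \<open>h\<close>; bit 1 appends
    \<open>y1\<close> and multiplies \<open>h\<close> by \<open>f\<close>. Since \<open>f\<close>
    nearly carries \<open>y1\<close> to \<open>y0\<close>, both choices put the new entry,
    conjugated by the new \<open>h\<close>, near \<open>y0\<close> conjugated by the old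
    \<open>h\<close>.\<close>
  define st where "st a = rec_nat (\<lambda>_. undefined, \<one>) (\<lambda>n (x, h). if a n then (x(n := Y1 n x h), h
      \<otimes> F n x h) else (x(n := Y0 n x h), h))"
    for a :: "nat \<Rightarrow> bool"
  define xs where "xs a n = fst (st a n)" for a n
  define hs where "hs a n = snd (st a n)" for a n
  define w0 where "w0 a n = Y0 n (xs a n) (hs a n)" for a n
  define w1 where "w1 a n = Y1 n (xs a n) (hs a n)" for a n
  define fs where "fs a n = F n (xs a n) (hs a n)" for a n
  have xs0: "xs a 0 = (\<lambda>_. undefined)" and hs0: "hs a 0 = \<one>" for a
    by (simp_all add: xs_def hs_def st_def)
  have xsS: "xs a (Suc n) = (if a n then (xs a n)(n := w1 a n) else (xs a n)(n := w0 a n))"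
    and hsS: "hs a (Suc n) = (if a n then hs a n \<otimes> fs a n else hs a n)" for a n
    by (auto simp: xs_def hs_def w0_def w1_def fs_def st_def case_prod_beta)
  have inv: "xs a n \<in> R n \<and> hs a n \<in> carrier G" for a n
  proof (induction n)
    case 0
    then show ?case by (simp add: xs0 hs0 R)
  next
    case (Suc n)
    then have "S n (xs a n) (hs a n) (w0 a n) (w1 a n) (fs a n)"
      unfolding w0_def w1_def fs_def using step' by blast
    then have "(xs a n)(n := w0 a n) \<in> R (Suc n)" "(xs a n)(n := w1 a n) \<in> R (Suc n)"
      "fs a n \<in> carrier G"
      unfolding S_def by blast+
    then show ?case using Suc unfolding xsS hsS by (auto simp del: fun_upd_apply)
  qed
  have S: "S n (xs a n) (hs a n) (w0 a n) (w1 a n) (fs a n)" for a n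
    unfolding w0_def w1_def fs_def using step' inv by blast
  have hc: "hs a n \<in> carrier G" for a n using inv by blast
  have fc: "fs a n \<in> carrier G" for a n using S by (auto simp: S_def)
  have w0A: "w0 a n \<in> A" and w1B: "w1 a n \<in> B" for a n using S by (auto simp: S_def)
  have wc: "w0 a n \<in> carrier G" "w1 a n \<in> carrier G" for a n
  proof -
    have "(xs a n)(n := w0 a n) \<in> {..<Suc n} \<rightarrow>\<^sub>E carrier G"
      "(xs a n)(n := w1 a n) \<in> {..<Suc n} \<rightarrow>\<^sub>E carrier G"
      using S[of n a] R(2) unfolding S_def by blast+
    from this[THEN PiE_mem, of n] show "w0 a n \<in> carrier G" "w1 a n \<in> carrier G" by auto
  qed
  define x where "x a i = (if a i then w1 a i else w0 a i)" for a i
  have xs_eq: "xs a n i = x a i" if "i < n" for a n i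
    using that by (induction n) (auto simp: xsS x_def less_Suc_eq)
  have xc: "x a i \<in> carrier G" for a i by (simp add: x_def wc)

  have \<rho>_step: "\<rho> (hs a n) (hs a (Suc n)) \<le> (1 / 2) ^ n" for a n
    using S[of n a] hc by (auto simp: S_def hsS)
  \<comment> \<open>The subtracted term is the part of the geometric series still to come; with it
    the induction closes.\<close>
  have \<rho>_tail: "\<rho> (hs a n) (hs a (n + k)) \<le> 2 * (1 / 2) ^ n - 2 * (1 / 2) ^ (n + k)" for a n k
  proof (induction k)
    case 0
    then show ?case using hc by simp
  next
    case (Suc k)
    have "\<rho> (hs a n) (hs a (n + Suc k)) \<le> \<rho> (hs a n) (hs a (n + k)) + \<rho> (hs a (n + k)) (hs a (Suc (n
        + k)))"
      using triangle[OF hc hc hc] by simp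
    also have "\<dots> \<le> 2 * (1 / 2) ^ n - 2 * (1 / 2) ^ (n + k) + (1 / 2) ^ (n + k)"
      using Suc \<rho>_step[of a "n + k"] by simp
    finally show ?case by simp
  qed
  have \<rho>_tail': "\<rho> (hs a n) (hs a m) < 2 * (1 / 2) ^ n" if "n \<le> m" for a n m
  proof -
    have "\<rho> (hs a n) (hs a m) \<le> 2 * (1 / 2) ^ n - 2 * (1 / 2) ^ m" using \<rho>_tail[of a n "m - n"] that
      by simp
    moreover have "2 * (1 / 2 :: real) ^ m > 0" by simp
    ultimately show ?thesis by linarith
  qed
  have "MCauchy (hs a)" for a
    unfolding MCauchy_def
  proof (intro conjI allI impI)
    show "range (hs a) \<subseteq> carrier G" using hc by auto
    fix e :: real assume "e > 0"
    then obtain N where N: "(1 / 2) ^ N < e / 4" using real_arch_pow_inv[of "e / 4" "1 / 2"] by auto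
    have "\<rho> (hs a n) (hs a n') < e" if "N \<le> n" "N \<le> n'" for n n'
      using triangle[of "hs a n" "hs a N" "hs a n'"] \<rho>_tail'[OF that(1), of a]
        \<rho>_tail'[OF that(2), of a] N hc commute[of "hs a n" "hs a N"]
      by auto
    then show "\<exists>N. \<forall>n n'. N \<le> n \<longrightarrow> N \<le> n' \<longrightarrow> \<rho> (hs a n) (hs a n') < e" by blast
  qed
  then have "\<exists>l. limitin mtopology (hs a) l sequentially" for a
    using complete by (auto simp: mcomplete_def)
  then obtain h where h: "\<And>a. limitin mtopology (hs a) (h a) sequentially" by metis
  have hcar: "h a \<in> carrier G" for a using h limitin_mspace by blast

  \<comment> \<open>New factors enter \<open>hs\<close> on the right, so invariance reduces the
    change to the displacement of \<open>x a i\<close> by \<open>fs a m\<close> alone.\<close>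
  have d_step: "d (conjugate (hs a (Suc m)) (x a i)) (conjugate (hs a m) (x a i)) \<le>
      \<delta> * (1 / 2) ^ Suc m" if "i < m" for a m i
  proof (cases "a m")
    case True
    have "d (conjugate (hs a (Suc m)) (x a i)) (conjugate (hs a m) (x a i))
        = d (conjugate (fs a m) (x a i)) (x a i)"
      using True hc fc xc by (simp add: hsS conjugate_mult d_conjugate)
    then show ?thesis using S[of m a] that xs_eq[of i m a] unfolding S_def by force
  next
    case False
    then show ?thesis using hc xc \<delta> by (simp add: hsS)
  qed
  have d_first: "d (conjugate (hs a (Suc i)) (x a i)) (conjugate (hs a i) (w0 a i)) \<le>
      \<delta> * (1 / 2) ^ Suc i" for a i
  proof (cases "a i")
    case True
    have "d (conjugate (hs a (Suc i)) (x a i)) (conjugate (hs a i) (w0 a i))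
        = d (conjugate (fs a i) (w1 a i)) (w0 a i)"
      using True hc fc wc by (simp add: hsS x_def conjugate_mult d_conjugate)
    then show ?thesis using S[of i a] unfolding S_def by force
  next
    case False
    then show ?thesis using hc wc \<delta> by (simp add: hsS x_def)
  qed
  have d_tail: "d (conjugate (hs a (Suc i + k)) (x a i)) (conjugate (hs a i) (w0 a i)) \<le>
      \<delta> * (1 / 2) ^ i - \<delta> * (1 / 2) ^ (Suc i + k)" for a i k
  proof (induction k)
    case 0
    then show ?case using d_first[of a i] by simp
  next
    case (Suc k)
    have "d (conjugate (hs a (Suc i + Suc k)) (x a i)) (conjugate (hs a i) (w0 a i)) \<le>
        d (conjugate (hs a (Suc i + Suc k)) (x a i)) (conjugate (hs a (Suc i + k)) (x a i)) + d
          (conjugate (hs a (Suc i + k)) (x a i)) (conjugate (hs a i) (w0 a i))"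
      using hc xc wc by (intro D.triangle) auto
    also have "\<dots> \<le> \<delta> * (1 / 2) ^ Suc (Suc i + k) + (\<delta> * (1 / 2) ^ i - \<delta> * (1 / 2) ^ (Suc i + k))"
      using Suc d_step[of i "Suc i + k" a] by (intro add_mono) auto
    finally show ?case by (simp add: field_simps)
  qed
  \<comment> \<open>\<open>hs a\<close> converges only for \<open>\<rho>\<close>. The estimate
    reaches the limit because it defines a closed set.\<close>
  have d_lim: "d (conjugate (h a) (x a i)) (conjugate (hs a i) (w0 a i)) \<le> \<delta>" for a i
  proof -
    define K where "K = {k \<in> topspace mtopology. d (conjugate k (x a i)) (conjugate (hs a i) (w0 a
        i)) \<le> \<delta>}"
    have "closedin mtopology K" unfolding K_def
      by (intro closedin_d_le_preimage continuous_map_conjugate continuous_group)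
        (use xc wc hc in auto)
    moreover have "\<forall>\<^sub>F n in sequentially. hs a n \<in> K"
      unfolding eventually_sequentially
    proof (intro exI allI impI)
      fix n assume "Suc i \<le> n"
      then obtain k where n: "n = Suc i + k" using le_Suc_ex by blast
      have "\<delta> * (1 / 2) ^ i \<le> \<delta> * 1" using \<delta> by (intro mult_left_mono) (auto simp: power_le_one)
      moreover have "\<delta> * (1 / 2) ^ (Suc i + k) \<ge> 0" using \<delta> by simp
      ultimately have "d (conjugate (hs a n) (x a i)) (conjugate (hs a i) (w0 a i)) \<le> \<delta>"
        using d_tail[of a i k] unfolding n by linarith
      then show "hs a n \<in> K" using hc by (simp add: K_def)
    qed
    ultimately have "h a \<in> K" using limitin_closedin[OF h] by simp
    then show ?thesis by (simp add: K_def)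
  qed
  \<comment> \<open>Up to level \<open>i\<close> the branches coincide, so both conjugates are
    within \<open>\<delta>\<close> of the same point, \<open>w0\<close> conjugated by
    \<open>hs\<close> at level \<open>i\<close>.\<close>
  have sep: "d (conjugate (h a) (w1 a i)) (conjugate (h b) (w0 b i)) \<le> 2 * \<delta>"
    if eq: "\<forall>j<i. a j = b j" and "a i" "\<not> b i" for a b i
  proof -
    have "xs a j = xs b j \<and> hs a j = hs b j" if "j \<le> i" for j
      using that eq by (induction j) (auto simp: xs0 hs0 xsS hsS w0_def w1_def fs_def)
    then have e: "hs a i = hs b i" "w0 a i = w0 b i" by (auto simp: w0_def)
    have "x a i = w1 a i" "x b i = w0 b i" using that by (auto simp: x_def)
    then have "d (conjugate (h a) (w1 a i)) (conjugate (hs b i) (w0 b i)) \<le> \<delta>"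
       "d (conjugate (h b) (w0 b i)) (conjugate (hs b i) (w0 b i)) \<le> \<delta>"
      using d_lim[of a i] d_lim[of b i] e by auto
    moreover have "d (conjugate (h a) (w1 a i)) (conjugate (h b) (w0 b i)) \<le>
       d (conjugate (h a) (w1 a i)) (conjugate (hs b i) (w0 b i)) + d (conjugate (hs b i) (w0 b i))
         (conjugate (h b) (w0 b i))"
      using hcar hc wc by (intro D.triangle) auto
    ultimately show ?thesis using D.commute[of "conjugate (hs b i) (w0 b i)"
      "conjugate (h b) (w0 b i)"] by linarith
  qed
  show thesis
  proof (rule that[of h])
    fix a b :: "nat \<Rightarrow> bool" assume ne: "a \<noteq> b"
    define i where "i = (LEAST i. a i \<noteq> b i)"
    have "\<exists>i. a i \<noteq> b i" using ne by auto
    then have i: "a i \<noteq> b i" unfolding i_def by (rule LeastI_ex)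
    have j: "\<forall>j<i. a j = b j" unfolding i_def using not_less_Least by blast
    show "\<exists>y0\<in>A \<inter> carrier G. \<exists>y1\<in>B \<inter> carrier G.
        d (conjugate (h a) y1) (conjugate (h b) y0) \<le> 2 * \<delta> \<or> d (conjugate (h b) y1) (conjugate
          (h a) y0) \<le> 2 * \<delta>"
    proof (cases "a i")
      case True
      then show ?thesis using sep[of i a b] i j w0A w1B wc by blast
    next
      case False
      then show ?thesis using sep[of i b a] i j w0A w1B wc by (metis IntI)
    qed
  qed (rule hcar)
qed

end

section \<open>Graded subgroups\<close>

lemma INF_add_const_ennreal:
  fixes f :: "'i \<Rightarrow> ennreal"
  assumes "I \<noteq> {}"
  shows "(INF i\<in>I. f i + c) = (INF i\<in>I. f i) + c"
  using continuous_at_Inf_mono[of "\<lambda>x. x + c" "f ` I"]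
  using continuous_add[of "at_right (Inf (f ` I))", of "\<lambda>x. x" "\<lambda>x. c"] assms
  by (auto simp: mono_def image_comp)

lemma ennreal_real_between:
  fixes a b :: ennreal
  assumes "a < b"
  obtains s where "0 \<le> s" "a < ennreal s" "ennreal s < b"
proof -
  obtain z where z: "a < z" "z < b" using dense[OF assms] by blast
  then obtain s where "0 \<le> s" "z = ennreal s" by (cases z rule: ennreal_cases) auto
  with z that show thesis by blast
qed

lemma (in group) graded_subgroup_inv: "graded_subgroup G L \<Longrightarrow> x \<in> carrier G \<Longrightarrow> L (inv x) = L x"
  by (simp add: graded_subgroup_def)

lemma (in group) graded_subgroup_mult_le:
  "graded_subgroup G L \<Longrightarrow> x \<in> carrier G \<Longrightarrow> y \<in> carrier G \<Longrightarrow> L (x \<otimes> y) \<le> L x + L y"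
  by (simp add: graded_subgroup_def)

lemma (in group) graded_subgroup_conjugate_le:
  assumes "graded_subgroup G L" "k \<in> carrier G" "x \<in> carrier G"
  shows "L (k \<otimes> x \<otimes> inv k) \<le> L k + L x + L k"
proof -
  have "L (k \<otimes> x \<otimes> inv k) \<le> L (k \<otimes> x) + L (inv k)"
    by (rule graded_subgroup_mult_le) (use assms in auto)
  also have "\<dots> \<le> (L k + L x) + L k"
    using assms by (intro add_mono graded_subgroup_mult_le) (auto simp: graded_subgroup_inv)
  finally show ?thesis .
qed

section \<open>Lipschitz graded subgroups: continuity at the identity and envelopes\<close>

context biinvariant_polish_group begin

lemma lipschitz_graded_subgroup_small_near_one:
  assumes ample: "ample_generics G mtopology d"
    and L: "graded_subgroup G L" and idx: "index_lt_continuum G L"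
    and c: "c > 0" and lip: "\<And>x y. x \<in> carrier G \<Longrightarrow> y \<in> carrier G \<Longrightarrow> L x \<le> L y + ennreal (c * d x y)"
    and r: "r > 0"
  obtains V where "openin mtopology V" "\<one> \<in> V" "\<And>g. g \<in> V \<Longrightarrow> L g \<le> ennreal r"
proof (cases "\<exists>U. openin mtopology U \<and> U \<noteq> {} \<and> meagre_in mtopology ({x \<in> carrier G. ennreal (r / 2)
    < L x} \<inter> U)")
  case True
  then obtain U where U: "openin mtopology U" "U \<noteq> {}"
      "meagre_in mtopology ({x \<in> carrier G. ennreal (r / 2) < L x} \<inter> U)" by blast
  \<comment> \<open>\<open>L\<close> is at most \<open>r / 2\<close> on a comeagre part of
    \<open>U\<close>, and quotients of two such points fill a neighbourhood of the identity, where
    the bound doubles to \<open>r\<close>.\<close>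
  have "meagre_in mtopology (U - {x \<in> carrier G. L x \<le> ennreal (r / 2)})"
    by (rule meagre_in_subset[OF U(3)]) auto
  then obtain V where V: "openin mtopology V" "\<one> \<in> V"
      "\<And>g. g \<in> V \<Longrightarrow> \<exists>s\<in>{x \<in> carrier G. L x \<le> ennreal (r / 2)} \<inter> carrier G.
         \<exists>t\<in>{x \<in> carrier G. L x \<le> ennreal (r / 2)} \<inter> carrier G. g = inv s \<otimes> t"
    using pettis[OF U(1,2)] by blast
  have "L g \<le> ennreal r" if "g \<in> V" for g
  proof -
    obtain s t where st: "s \<in> carrier G" "t \<in> carrier G" "L s \<le> ennreal (r / 2)"
      "L t \<le> ennreal (r / 2)" "g = inv s \<otimes> t"
      using V(3)[OF \<open>g \<in> V\<close>] by blast
    have "L g \<le> L (inv s) + L t" unfolding st(5) by (rule graded_subgroup_mult_le)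
      (use L st in auto)
    also have "\<dots> \<le> ennreal (r / 2) + ennreal (r / 2)"
      using L st by (intro add_mono) (auto simp: graded_subgroup_inv)
    also have "\<dots> = ennreal r" using r by (simp flip: ennreal_plus)
    finally show ?thesis .
  qed
  with V that show ?thesis by blast
next
  case False
  define A where "A = {x \<in> carrier G. L x < ennreal (r / 8)}"
  define B where "B = {x \<in> carrier G. ennreal (r / 2) < L x}"
  have A: "\<not> meagre_in mtopology A"
    unfolding A_def using not_meagre_in_graded_sublevel[OF L idx, of "r / 8"] r by simp
  have B: "\<not> meagre_in mtopology (B \<inter> U)" if "openin mtopology U" "U \<noteq> {}" for U
    using False that unfolding B_def by blast
  \<comment> \<open>Chosen so that the Lipschitz error \<open>c * (2 * \<delta>)\<close> equals
    \<open>r / 8\<close>.\<close>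
  define \<delta> where "\<delta> = r / (16 * c)"
  have \<delta>: "\<delta> > 0" using r c by (simp add: \<delta>_def)
  obtain g where g: "\<And>n. g n \<in> {..<n} \<rightarrow>\<^sub>E carrier G"
      "\<And>n. comeagre_in (product_topology (\<lambda>_. mtopology) {..<n}) (orbit_dclosure G d n (g n))"
    using ample unfolding ample_generics_def by metis
  obtain R where R: "\<And>n. R n \<subseteq> orbit_dclosure G d n (g n)" "(\<lambda>_. undefined) \<in> R 0"
      "\<And>n x. x \<in> R n \<Longrightarrow> comeagre_in mtopology {y \<in> topspace mtopology. x(n := y) \<in> R (Suc n)}"
    using hereditarily_comeagre[OF second_countable g(2)] by blast
  have Rc: "R n \<subseteq> {..<n} \<rightarrow>\<^sub>E carrier G" for n
    using R(1)[of n] unfolding orbit_dclosure_def by blast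
  have step: "\<exists>y0 y1 f. y0 \<in> A \<and> y1 \<in> B \<and> x(n := y0) \<in> R (Suc n) \<and> x(n := y1) \<in> R (Suc n)
      \<and> f \<in> carrier G
        \<and> \<rho> h (h \<otimes> f) < (1 / 2) ^ n \<and> (\<forall>i<n. d (conjugate f (x i)) (x i) < \<delta> * (1 / 2) ^ Suc n)
        \<and> d (conjugate f y1) y0 < \<delta> * (1 / 2) ^ Suc n" if x: "x \<in> R n" and h: "h
          \<in> carrier G" for n x h
  proof -
    have x': "x \<in> {..<n} \<rightarrow> carrier G" using x Rc[of n] by auto
    have C: "x(n := y) \<in> orbit_dclosure G d (Suc n) (g (Suc n))"
      if "y \<in> {y \<in> topspace mtopology. x(n := y) \<in> R (Suc n)}" for y
      using that R(1)[of "Suc n"] by blast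
    have pos: "\<delta> * (1 / 2) ^ Suc n > 0" "(1 / 2 :: real) ^ n > 0" using \<delta> by simp_all
    show ?thesis
      by (rule generic_extension[OF g(1) x' h R(3)[OF x] C A B pos]) blast+
  qed
  obtain h :: "(nat \<Rightarrow> bool) \<Rightarrow> 'a" where h: "\<And>a. h a \<in> carrier G"
    "\<And>a b. a \<noteq> b \<Longrightarrow> \<exists>y0\<in>A \<inter> carrier G. \<exists>y1\<in>B \<inter> carrier G.
        d (conjugate (h a) y1) (conjugate (h b) y0) \<le> 2 * \<delta> \<or> d (conjugate (h b) y1) (conjugate
          (h a) y0) \<le> 2 * \<delta>"
    by (rule separated_family_of_step[of R A B, OF step R(2) Rc \<delta>]) (assumption | rule that)+
  have big: "ennreal (r / 8) \<le> L (inv u \<otimes> v)"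
    if u: "u \<in> carrier G" and v: "v \<in> carrier G" and y: "y0 \<in> A" "y1 \<in> B" and
      "d (conjugate u y1) (conjugate v y0) \<le> 2 * \<delta>" for u v y0 y1
  proof (rule ccontr)
    assume "\<not> ennreal (r / 8) \<le> L (inv u \<otimes> v)"
    then have k: "L (inv u \<otimes> v) < ennreal (r / 8)" by simp
    have yc: "y0 \<in> carrier G" "y1 \<in> carrier G" using y by (auto simp: A_def B_def)
    let ?k = "inv u \<otimes> v"
    have "d (conjugate u y1) (conjugate u (conjugate ?k y0)) = d y1 (conjugate ?k y0)"
      using u v yc by (intro d_conjugate) auto
    moreover have "conjugate u (conjugate ?k y0) = conjugate v y0"
      using u v yc by (simp flip: conjugate_mult m_assoc)
    ultimately have "d y1 (conjugate ?k y0) \<le> 2 * \<delta>" using that by simp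
    then have cd: "c * d y1 (conjugate ?k y0) \<le> r / 8"
      using c by (simp add: \<delta>_def field_simps)
    have "L y1 \<le> L (conjugate ?k y0) + ennreal (c * d y1 (conjugate ?k y0))"
      using u v yc by (intro lip) auto
    also have "\<dots> \<le> (L ?k + L y0 + L ?k) + ennreal (r / 8)"
      using u v yc cd graded_subgroup_conjugate_le[OF L, of ?k y0]
      by (intro add_mono ennreal_leI) (auto simp: conjugate_def)
    also have "\<dots> \<le> (ennreal (r / 8) + ennreal (r / 8) + ennreal (r / 8)) + ennreal (r / 8)"
      using k y by (intro add_mono) (auto simp: A_def)
    also have "\<dots> = ennreal (r / 2)" using r by (simp flip: ennreal_plus)
    finally show False using y by (auto simp: B_def)
  qed
  \<comment> \<open>For given \<open>a\<close> and \<open>b\<close> either branch may be the one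
    that takes \<open>y1\<close>; symmetry makes the lower bound independent of this.\<close>
  have sym: "L (inv u \<otimes> v) = L (inv v \<otimes> u)" if "u \<in> carrier G" "v \<in> carrier G" for u v
  proof -
    have "L (inv v \<otimes> u) = L (inv (inv u \<otimes> v))" using that by (simp add: inv_mult_group)
    then show ?thesis using L that by (simp add: graded_subgroup_inv)
  qed
  have "ennreal (r / 8) \<le> L (inv (h a) \<otimes> h b)" if ne: "a \<noteq> b" for a b
    using h(2)[OF ne] big[OF h(1) h(1), of _ _ a b] big[OF h(1) h(1), of _ _ b a] sym[OF h(1) h(1),
      of a b]
    by auto
  then have False
    using r by (intro graded_subgroup_index_separated[OF L idx h(1), of "r / 8"]) auto
  then show ?thesis ..
qed

text \<open>The Pasch-Hausdorff envelope, i.e. the infimal convolution of \<open>H\<close> with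
  \<open>c * d\<close>: for \<open>c > 0\<close> the largest \<open>c\<close>-Lipschitz function
  below \<open>H\<close>.\<close>

definition lipschitz_part :: "('a \<Rightarrow> ennreal) \<Rightarrow> real \<Rightarrow> 'a \<Rightarrow> ennreal" where
  "lipschitz_part H c x = (INF y\<in>carrier G. H y + ennreal (c * d x y))"

lemma lipschitz_part_le: "x \<in> carrier G \<Longrightarrow> lipschitz_part H c x \<le> H x"
  unfolding lipschitz_part_def by (rule INF_lower2[of x]) auto

lemma lipschitz_part_lipschitz:
  assumes c: "c > 0" and x: "x \<in> carrier G" "y \<in> carrier G"
  shows "lipschitz_part H c x \<le> lipschitz_part H c y + ennreal (c * d x y)"
proof -
  have "lipschitz_part H c x \<le> (H z + ennreal (c * d y z)) + ennreal (c * d x y)"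
    if z: "z \<in> carrier G" for z
  proof -
    have "c * d x z \<le> c * d y z + c * d x y"
      using D.triangle[OF x z] c by (simp flip: distrib_left add: add.commute)
    then have "ennreal (c * d x z) \<le> ennreal (c * d y z) + ennreal (c * d x y)"
      using c by (simp flip: ennreal_plus add: ennreal_leI)
    then have "H z + ennreal (c * d x z) \<le> (H z + ennreal (c * d y z)) + ennreal (c * d x y)"
      by (simp add: add.assoc add_left_mono)
    then show ?thesis unfolding lipschitz_part_def[of H c x] by (rule INF_lower2[OF z])
  qed
  then have "lipschitz_part H c x \<le> (INF z\<in>carrier G. (H z + ennreal (c * d y z))
      + ennreal (c * d x y))"
    by (intro INF_greatest)
  also have "\<dots> = lipschitz_part H c y + ennreal (c * d x y)"
    unfolding lipschitz_part_def by (rule INF_add_const_ennreal) (use one_closed in blast)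
  finally show ?thesis .
qed

text \<open>Bi-invariance gives
  \<open>d (x \<otimes> y) (a \<otimes> b) \<le> d x a + d y b\<close>, so competitors
  \<open>a\<close> for \<open>x\<close> and \<open>b\<close> for \<open>y\<close> multiply to a
  competitor for \<open>x \<otimes> y\<close>. It also makes inversion an isometry, which handles
  inverses.\<close>

lemma graded_subgroup_lipschitz_part:
  assumes H: "graded_subgroup G H" and c: "c > 0"
  shows "graded_subgroup G (lipschitz_part H c)"
proof -
  have ne: "carrier G \<noteq> {}" using one_closed by blast
  have H1: "H \<one> = 0" and Hinv: "\<And>x. x \<in> carrier G \<Longrightarrow> H (inv x) = H x"
    and Hmult: "\<And>x y. x \<in> carrier G \<Longrightarrow> y \<in> carrier G \<Longrightarrow> H (x \<otimes> y) \<le> H x + H y"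
    using H by (auto simp: graded_subgroup_def)
  \<comment> \<open>Multiplying by \<open>x\<close> on the left and \<open>y\<close> on the right
    exchanges the two points.\<close>
  have d_inv: "d (inv x) (inv y) = d x y" if "x \<in> carrier G" "y \<in> carrier G" for x y
  proof -
    have "d (inv x) (inv y) = d (x \<otimes> inv x) (x \<otimes> inv y)"
      by (rule d_mult_left[symmetric]) (use that in auto)
    also have "\<dots> = d (x \<otimes> inv x \<otimes> y) (x \<otimes> inv y \<otimes> y)"
      by (rule d_mult_right[symmetric]) (use that in auto)
    also have "\<dots> = d x y" using that by (simp add: m_assoc D.commute)
    finally show ?thesis .
  qed
  have inv_le: "lipschitz_part H c (inv x) \<le> lipschitz_part H c x" if x: "x \<in> carrier G" for x
    unfolding lipschitz_part_def[of H c x]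
  proof (rule INF_greatest)
    fix y assume y: "y \<in> carrier G"
    have "lipschitz_part H c (inv x) \<le> H (inv y) + ennreal (c * d (inv x) (inv y))"
      unfolding lipschitz_part_def by (rule INF_lower) (use y in auto)
    then show "lipschitz_part H c (inv x) \<le> H y + ennreal (c * d x y)"
      using x y by (simp add: Hinv d_inv)
  qed
  have mult: "lipschitz_part H c (x \<otimes> y) \<le> lipschitz_part H c x + lipschitz_part H c y"
    if x: "x \<in> carrier G" and y: "y \<in> carrier G" for x y
  proof -
    have *: "lipschitz_part H c (x \<otimes> y) \<le> (H b + ennreal (c * d y b)) + (H a + ennreal (c * d x a))"
      if a: "a \<in> carrier G" and b: "b \<in> carrier G" for a b
    proof -
      have "d (x \<otimes> y) (a \<otimes> b) \<le> d (x \<otimes> y) (a \<otimes> y) + d (a \<otimes> y) (a \<otimes> b)"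
        using x y a b by (intro D.triangle) auto
      also have "\<dots> = d x a + d y b" using x y a b by (simp add: d_mult_left d_mult_right)
      finally have "c * d (x \<otimes> y) (a \<otimes> b) \<le> c * d x a + c * d y b"
        using c by (simp flip: distrib_left)
      then have dd: "ennreal (c * d (x \<otimes> y) (a \<otimes> b)) \<le> ennreal (c * d x a) + ennreal (c * d y b)"
        using c by (simp flip: ennreal_plus add: ennreal_leI)
      have "lipschitz_part H c (x \<otimes> y) \<le> H (a \<otimes> b) + ennreal (c * d (x \<otimes> y) (a \<otimes> b))"
        unfolding lipschitz_part_def by (rule INF_lower) (use a b in auto)
      also have "\<dots> \<le> (H a + H b) + (ennreal (c * d x a) + ennreal (c * d y b))"
        by (intro add_mono Hmult a b dd)
      finally show ?thesis by (simp add: ac_simps)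
    qed
    \<comment> \<open>The two infima are taken one at a time, with the contribution of the other
      competitor as the additive constant.\<close>
    have "lipschitz_part H c (x \<otimes> y) \<le> lipschitz_part H c y + (H a + ennreal (c * d x a))"
      if "a \<in> carrier G" for a
    proof -
      have "lipschitz_part H c (x \<otimes> y) \<le> (INF b\<in>carrier G. (H b + ennreal (c * d y b)) + (H a
          + ennreal (c * d x a)))"
        by (intro INF_greatest * that)
      then show ?thesis unfolding lipschitz_part_def[of H c y] INF_add_const_ennreal[OF ne] .
    qed
    then have "lipschitz_part H c (x \<otimes> y) \<le> (INF a\<in>carrier G. (H a + ennreal (c * d x a))
        + lipschitz_part H c y)"
      by (intro INF_greatest) (simp add: add.commute)
    then show ?thesis unfolding lipschitz_part_def[of H c x] INF_add_const_ennreal[OF ne] .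
  qed
  have "lipschitz_part H c \<one> \<le> 0" using lipschitz_part_le[of \<one> H c] H1 by simp
  moreover have "lipschitz_part H c (inv x) = lipschitz_part H c x" if "x \<in> carrier G" for x
    using inv_le[OF that] inv_le[of "inv x"] that by (intro antisym) auto
  ultimately show ?thesis using mult by (simp add: graded_subgroup_def)
qed

text \<open>The envelope lies below \<open>H\<close>, so a dense set for \<open>H\<close> remains
  dense.\<close>

lemma index_lt_continuum_lipschitz_part:
  assumes "index_lt_continuum G H" shows "index_lt_continuum G (lipschitz_part H c)"
proof -
  obtain Z where Z: "dH_dense G H Z" "Z \<prec> (UNIV :: real set)"
    using assms by (auto simp: index_lt_continuum_def)
  have "dH_dense G (lipschitz_part H c) Z"
    unfolding dH_dense_def
  proof (intro conjI ballI allI impI)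
    show "Z \<subseteq> carrier G" using Z by (simp add: dH_dense_def)
    fix g and e :: real assume g: "g \<in> carrier G" and "e > 0"
    then obtain x where x: "x \<in> Z" "H (inv g \<otimes> x) < ennreal e"
      using Z(1) unfolding dH_dense_def by blast
    then have "lipschitz_part H c (inv g \<otimes> x) \<le> H (inv g \<otimes> x)"
      using Z g by (intro lipschitz_part_le) (auto simp: dH_dense_def)
    then show "\<exists>x\<in>Z. lipschitz_part H c (inv g \<otimes> x) < ennreal e" using x
      by (meson order_le_less_trans)
  qed
  with Z(2) show ?thesis by (auto simp: index_lt_continuum_def)
qed

text \<open>Near \<open>x\<close> lower semi-continuity keeps \<open>H\<close> above some
  \<open>s > r\<close>; away from \<open>x\<close> the penalty \<open>c * d x y\<close> alone
  reaches \<open>s\<close> once \<open>c\<close> is large.\<close>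

lemma less_lipschitz_part:
  assumes H: "lsc_on D.mtopology H" and x: "x \<in> carrier G" and r: "ennreal r < H x"
  obtains c where "c > 0" "ennreal r < lipschitz_part H c x"
proof -
  obtain s where s: "0 \<le> s" "ennreal r < ennreal s" "ennreal s < H x"
    using ennreal_real_between[OF r] .
  have s0: "s > 0" using s(1,2) by (cases "s = 0") auto
  have "openin D.mtopology {y \<in> carrier G. ennreal s < H y}" using H by (simp add: lsc_on_def)
  moreover have "x \<in> {y \<in> carrier G. ennreal s < H y}" using x s by simp
  ultimately obtain \<delta> where \<delta>: "\<delta> > 0" "D.mball x \<delta> \<subseteq> {y \<in> carrier G. ennreal s < H y}"
    by (meson D.openin_mtopology)
  \<comment> \<open>At distance \<open>\<delta>\<close> from \<open>x\<close> the penalty is then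
    exactly \<open>s\<close>.\<close>
  define c where "c = s / \<delta>"
  have "ennreal s \<le> lipschitz_part H c x"
    unfolding lipschitz_part_def
  proof (rule INF_greatest)
    fix y assume y: "y \<in> carrier G"
    show "ennreal s \<le> H y + ennreal (c * d x y)"
    proof (cases "d x y < \<delta>")
      case True
      then have "ennreal s < H y" using \<delta>(2) x y by auto
      then show ?thesis by (meson add_increasing2 less_imp_le zero_le)
    next
      case False
      then have "s \<le> c * d x y" using \<delta>(1) s0 by (simp add: c_def field_simps)
      then have "ennreal s \<le> ennreal (c * d x y)" by (rule ennreal_leI)
      then show ?thesis by (meson add_increasing zero_le)
    qed
  qed
  then show thesis using that[of c] s \<delta>(1) s0 by (simp add: c_def)
qed

section \<open>From Lipschitz to lower semi-continuous graded subgroups\<close>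

lemma openin_left_translate_preimage:
  assumes "openin mtopology V" "x \<in> carrier G"
  shows "openin mtopology {y \<in> carrier G. inv x \<otimes> y \<in> V}"
proof -
  have "openin mtopology {y \<in> topspace mtopology. inv x \<otimes> y \<in> V}"
    by (rule openin_continuous_map_preimage[OF _ assms(1)])
      (intro continuous_group inv_closed assms(2))
  then show ?thesis by simp
qed

text \<open>If \<open>r < H x\<close>, some envelope \<open>L\<close> already exceeds
  \<open>r\<close> at \<open>x\<close> with room \<open>e\<close> to spare. Since \<open>L\<close>
  is at most \<open>e\<close> near the identity, it stays above \<open>r\<close> on a translate of
  that neighbourhood, and \<open>H\<close> lies above \<open>L\<close>.\<close>

lemma closedin_graded_sublevel:
  assumes ample: "ample_generics G mtopology d"
    and H: "graded_subgroup G H" "index_lt_continuum G H" "lsc_on D.mtopology H"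
  shows "closedin mtopology {x \<in> carrier G. H x \<le> ennreal r}"
proof -
  have "openin mtopology {x \<in> carrier G. ennreal r < H x}"
  proof (subst openin_subopen, intro ballI)
    fix x assume "x \<in> {x \<in> carrier G. ennreal r < H x}"
    then have x: "x \<in> carrier G" "ennreal r < H x" by auto
    obtain c where c: "c > 0" "ennreal r < lipschitz_part H c x"
      using less_lipschitz_part[OF H(3) x] .
    define L where "L = lipschitz_part H c"
    have L: "graded_subgroup G L" unfolding L_def
      by (rule graded_subgroup_lipschitz_part[OF H(1) c(1)])
    have L_le: "L y \<le> H y" if "y \<in> carrier G" for y unfolding L_def
      by (rule lipschitz_part_le[OF that])
    obtain s where s: "0 \<le> s" "ennreal r < ennreal s" "ennreal s < L x"
      using ennreal_real_between[OF c(2)] unfolding L_def .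
    \<comment> \<open>\<open>ennreal r\<close> is 0 for negative \<open>r\<close>, so the gap is
      measured from \<open>max r 0\<close>.\<close>
    define e where "e = s - max r 0"
    have e: "e > 0" "ennreal r + ennreal e = ennreal s"
    proof -
      have "max r 0 < s" using s(1,2) by (cases "r \<ge> 0") (auto simp: ennreal_less_iff ennreal_neg)
      then show "e > 0" by (simp add: e_def)
      have "ennreal r = ennreal (max r 0)" by (cases "r \<ge> 0") (auto simp: ennreal_neg)
      then show "ennreal r + ennreal e = ennreal s" using \<open>e > 0\<close>
        by (simp add: e_def flip: ennreal_plus)
    qed
    have idx: "index_lt_continuum G L" unfolding L_def
      by (rule index_lt_continuum_lipschitz_part[OF H(2)])
    have lip: "L x \<le> L y + ennreal (c * d x y)" if "x \<in> carrier G" "y \<in> carrier G" for x y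
      unfolding L_def by (rule lipschitz_part_lipschitz[OF c(1) that])
    obtain V where V: "openin mtopology V" "\<one> \<in> V" "\<And>g. g \<in> V \<Longrightarrow> L g \<le> ennreal e"
      by (rule lipschitz_graded_subgroup_small_near_one[OF ample L idx c(1) lip e(1)])
        (assumption | rule that)+
    have "ennreal r < H y" if y: "y \<in> carrier G" "inv x \<otimes> y \<in> V" for y
    proof (rule ccontr)
      assume "\<not> ennreal r < H y"
      then have Ly: "L y \<le> ennreal r" using L_le[OF y(1)] by simp
      have "L x = L (y \<otimes> inv (inv x \<otimes> y))" using x y by (simp add: inv_mult_group flip: m_assoc)
      also have "\<dots> \<le> L y + L (inv (inv x \<otimes> y))" by (rule graded_subgroup_mult_le)
        (use L x y in auto)
      also have "\<dots> = L y + L (inv x \<otimes> y)" using L x y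
        by (simp add: graded_subgroup_inv del: inv_mult_group)
      also have "\<dots> \<le> ennreal r + ennreal e" by (intro add_mono Ly V(3) y)
      finally show False using s(3) e(2) by simp
    qed
    then show "\<exists>T. openin mtopology T \<and> x \<in> T \<and> T \<subseteq> {x \<in> carrier G. ennreal r < H x}"
      using V(2) x openin_left_translate_preimage[OF V(1) x(1)]
      by (intro exI[of _ "{y \<in> carrier G. inv x \<otimes> y \<in> V}"]) auto
  qed
  moreover have "carrier G - {x \<in> carrier G. H x \<le> ennreal r} = {x \<in> carrier G. ennreal r < H x}"
    by auto
  ultimately show ?thesis unfolding closedin_def by auto
qed

lemma usc_on_graded_subgroup:
  assumes ample: "ample_generics G mtopology d"
    and H: "graded_subgroup G H" "index_lt_continuum G H" "lsc_on D.mtopology H"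
  shows "usc_on mtopology H"
  unfolding usc_on_def topspace_mtopology
proof (intro allI, subst openin_subopen, intro ballI)
  fix c x assume "x \<in> {x \<in> carrier G. H x < c}"
  then have x: "x \<in> carrier G" "H x < c" by auto
  \<comment> \<open>Two finite values \<open>t < s\<close> between \<open>H x\<close> and
    \<open>c\<close> leave a positive real margin \<open>s - t\<close>, even when \<open>c\<close>
    is infinite.\<close>
  obtain s where s: "0 \<le> s" "H x < ennreal s" "ennreal s < c" using ennreal_real_between[OF x(2)] .
  obtain t where t: "0 \<le> t" "H x < ennreal t" "ennreal t < ennreal s"
    using ennreal_real_between[OF s(2)] .
  define e where "e = s - t"
  have e: "e > 0" using t by (simp add: e_def ennreal_less_iff)
  define F where "F = {x \<in> carrier G. H x \<le> ennreal (e / 2)}"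
  have F: "closedin mtopology F" unfolding F_def by (rule closedin_graded_sublevel[OF ample H])
  have "{x \<in> carrier G. H x < ennreal (e / 2)} \<inter> topspace mtopology \<subseteq> F"
    by (auto simp: F_def)
  moreover have "\<not> meagre_in mtopology {x \<in> carrier G. H x < ennreal (e / 2)}"
    by (rule not_meagre_in_graded_sublevel[OF H(1,2)]) (use e in simp)
  ultimately have "\<not> meagre_in mtopology F" using meagre_in_subset by blast
  \<comment> \<open>\<open>F\<close> is closed, so its complement is open; were it also dense,
    \<open>F\<close> would be meagre. Hence \<open>F\<close> contains a non-empty open set, and
    Pettis' theorem applies to it.\<close>
  then have "\<not> dense_openin mtopology (carrier G - F)"
    using dense_openin_imp_comeagre_in[of mtopology "carrier G - F"] by (auto simp: meagre_in_def)
  then obtain U where U: "openin mtopology U" "U \<noteq> {}" "(carrier G - F) \<inter> U = {}"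
    using F unfolding dense_openin_iff closedin_def by auto
  then have "U - F = {}" using openin_subset[OF U(1)] by auto
  then have "meagre_in mtopology (U - F)" by (metis meagre_in_empty)
  then obtain V where V: "openin mtopology V" "\<one> \<in> V"
      "\<And>g. g \<in> V \<Longrightarrow> \<exists>u\<in>F \<inter> carrier G. \<exists>v\<in>F \<inter> carrier G. g = inv u \<otimes> v"
    using pettis[OF U(1,2)] by blast
  have V_le: "H g \<le> ennreal e" if "g \<in> V" for g
  proof -
    obtain u v where uv: "u \<in> F" "v \<in> F" "u \<in> carrier G" "v \<in> carrier G" "g = inv u \<otimes> v"
      using V(3)[OF \<open>g \<in> V\<close>] by blast
    have "H g \<le> H (inv u) + H v" unfolding uv(5) by (rule graded_subgroup_mult_le)
      (use H(1) uv in auto)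
    also have "\<dots> \<le> ennreal (e / 2) + ennreal (e / 2)"
      using H(1) uv by (intro add_mono) (auto simp: graded_subgroup_inv F_def)
    also have "\<dots> = ennreal e" using e by (simp flip: ennreal_plus)
    finally show ?thesis .
  qed
  have "H y < c" if y: "y \<in> carrier G" "inv x \<otimes> y \<in> V" for y
  proof -
    have "H y = H (x \<otimes> (inv x \<otimes> y))" using x y by (simp flip: m_assoc)
    also have "\<dots> \<le> H x + H (inv x \<otimes> y)" by (rule graded_subgroup_mult_le) (use H(1) x y in auto)
    also have "\<dots> \<le> ennreal t + ennreal e" using t V_le[OF y(2)] by (intro add_mono) auto
    also have "\<dots> = ennreal s" using t e by (simp add: e_def flip: ennreal_plus)
    finally show ?thesis using s by simp
  qed
  then show "\<exists>T. openin mtopology T \<and> x \<in> T \<and> T \<subseteq> {x \<in> carrier G. H x < c}"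
    using V(2) x openin_left_translate_preimage[OF V(1) x(1)]
    by (intro exI[of _ "{y \<in> carrier G. inv x \<otimes> y \<in> V}"]) auto
qed

end

theorem theorem4p4:
  fixes G :: "('a, 'b) monoid_scheme" and \<tau> :: "'a topology" and d :: "'a \<Rightarrow> 'a \<Rightarrow> real"
  assumes "Polish_topometric_group G \<tau> d"
    and "ample_generics G \<tau> d"
  shows "\<forall>H :: 'a \<Rightarrow> ennreal. graded_subgroup G H
           \<and> lsc_on (Metric_space.mtopology (carrier G) d) H
           \<and> index_lt_continuum G H
           \<longrightarrow> usc_on \<tau> H"
proof -
  have "group G" and top: "topspace \<tau> = carrier G" and P: "completely_metrizable_space \<tau>"
    "separable_space \<tau>"
    and mult: "continuous_map (prod_topology \<tau> \<tau>) \<tau> (\<lambda>(x, y). x \<otimes>\<^bsub>G\<^esub> y)"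
    and inv: "continuous_map \<tau> \<tau> (\<lambda>x. inv\<^bsub>G\<^esub> x)"
    and D: "Metric_space (carrier G) d"
    and bi: "\<And>k x y. k \<in> carrier G \<Longrightarrow> x \<in> carrier G \<Longrightarrow> y \<in> carrier G \<Longrightarrow>
           d (k \<otimes>\<^bsub>G\<^esub> x) (k \<otimes>\<^bsub>G\<^esub> y) = d x y \<and> d (x \<otimes>\<^bsub>G\<^esub> k) (y \<otimes>\<^bsub>G\<^esub> k) = d x y"
    and lsc: "\<And>r. closedin (prod_topology \<tau> \<tau>) {(g, h) \<in> carrier G \<times> carrier G. d g h \<le> r}"
    using assms(1) unfolding Polish_topometric_group_def Polish_space_def by blast+
  obtain M \<rho> where M: "Metric_space M \<rho>" "Metric_space.mcomplete M \<rho>"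
    "\<tau> = Metric_space.mtopology M \<rho>"
    using P(1) by (auto simp: completely_metrizable_space_def)
  \<comment> \<open>The locale requires the complete metric to live on \<open>carrier G\<close>
    itself.\<close>
  have "M = carrier G" using top M(1,3) by (simp add: Metric_space.topspace_mtopology)
  note M = M[unfolded this]
  interpret biinvariant_polish_group G \<rho> d
  proof (intro biinvariant_polish_group.intro polish_group.intro
    biinvariant_polish_group_axioms.intro polish_group_axioms.intro)
  qed (use \<open>group G\<close> M D P(2) mult inv bi lsc in auto)
  show ?thesis using usc_on_graded_subgroup assms(2) M(3) by blast
qed

end
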